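(* There is an open dense subset $\mathcal{Y}\subset\mathcal{U}$ (for the $C^2$ topology) such that for any $\gamma\in\mathcal{Y}$, the glancing set $\mathcal{G}$ of $\omega_\gamma$ is contained in the subset of $\gamma$ where the curvature $\kappa>0$. In particular the glancing points all have order $2$ (with respect to every glancing line through them). In addition, for any $\gamma\in\mathcal{U}$, there exists a compact set $K\subset\mathbb{S}^1$ of measure zero such that $R_\theta\gamma\in\mathcal{Y}$ for all $\theta\in\Theta(\omega_\gamma)\setminus K$.
   Context: $\mathbb{T}^2=\mathbb{R}^2/\mathbb{Z}^2$; $\pi:\mathbb{R}^2\to\mathbb{T}^2$ is the projection; $\mathbb{S}^1\simeq\mathbb{R}/2\pi\mathbb{Z}$. A bounded open set $\omega\subset\mathbb{R}^2$ is properly projected on the torus if $\pi|_{\overline{\omega}}$ is one-to-one. $R_\theta$ is the rotation of $\mathbb{R}^2$ by angle $\theta\in\mathbb{S}^1$, and $\Theta(\omega)=\{\theta\in\mathbb{S}^1: R_\theta\omega\text{ is properly projected on the torus}\}$. For a simple closed curve $\gamma\in C^2(\mathbb{S}^1;\mathbb{R}^2)$, $\omega_\gamma$ is the bounded open region of $\mathbb{R}^2$ enclosed by $\gamma$. $\mathcal{U}$ is the (open) set of simple closed curves $\gamma\in C^2(\mathbb{S}^1;\mathbb{R}^2)$ such that $\omega_\gamma$ is properly projected on the torus and $\dot\gamma(t)\ne0$ for all $t\in\mathbb{S}^1$, with the $C^2$ topology. For such $\gamma$, $\omega_\gamma$ (and $\gamma$) is identified with its image in $\mathbb{T}^2$.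 The curvature is $\kappa(\gamma(t))=|\dot\gamma(t)|^{-3}\sqrt{|\ddot\gamma(t)|^2|\dot\gamma(t)|^2-(\ddot\gamma(t)\cdot\dot\gamma(t))^2}$. $(R_\theta\gamma)(t)=R_\theta(\gamma(t))$. Glancing: let $\omega\subset\mathbb{T}^2$ be open. For $z\in\mathbb{T}^2$, $v\in\mathbb{S}^1$ (unit vector), $L_{z,v}=\{z+tv:t\in\mathbb{R}\}\subset\mathbb{T}^2$. A line $L$ is glancing if $L\cap\omega=\varnothing$ and $L\cap\partial\omega\ne\varnothing$. The glancing set $\mathcal{G}$ of $\omega$ is the set of $z\in\partial\omega$ lying on some glancing line. If $L$ is a glancing line with direction $v$ and $z\in L\cap\partial\omega$, then $z$ is a one-sided glancing point relative to $v$ if there exist a neighborhood $U$ of $z$, $w\in\mathbb{S}^1$ with $v\cdot w=0$, and $\varepsilon_0>0$ such that $L_{z+sw,v}\cap U\cap\omega=\varnothing$ for all $s\in(0,\varepsilon_0)$; otherwise $z$ is two-sided relative to $v$. Order: let $L$ be a glancing line, $z\in\partial\omega\cap L$, $\eta>0$. The point $z$ has order $\eta$ (with respect to $L$) if there is an affine coordinate chart $(\psi,U)$ about $z$ (i.e. $U=\pi(\widetilde U)\ni z$ with $\widetilde U\subset\mathbb{R}^2$ open, $\pi|_{\widetilde U}$ injective, and $\psi\circ\pi|_{\widetilde U}$ the restriction of an invertible affine map of $\mathbb{R}^2$) with $\psi(z)=(0,0)$ and $\psi(L\cap U)=\{(x,y)\in\psi(U):x=0\}$, and there are constants $C_{out}>C_{in}>1$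 such that, with $$\Omega_\eta=\{(x,y)\in\psi(U):|y|^\eta\le C_{out}|x|\},\qquad \mathcal{F}_\eta=\{(x,y)\in\psi(U)\setminus\{(0,0)\}:C_{in}^{-1}|y|^\eta\le|x|\le C_{in}|y|^\eta\},$$ one has: if $z$ is one-sided relative to the direction of $L$, then $\mathcal{F}_\eta\cap\{x\ge0,y\ge0\}\subset\psi(\omega\cap U)\subset\Omega_\eta\cap\{x\ge0\}$; if $z$ is two-sided relative to the direction of $L$, then either $\mathcal{F}_\eta\cap\{y\ge0\}\subset\psi(\omega\cap U)\subset\Omega_\eta$ or $\mathcal{F}_\eta\cap\{xy\ge0\}\subset\psi(\omega\cap U)\subset\Omega_\eta$. *)

theory Defs
  imports "HOL-Analysis.Analysis"
begin

section \<open>The circle and the flat torus\<close>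

quotient_type circle = real / "\<lambda>s t. \<exists>k::int. t = s + 2 * pi * of_int k"
  morphisms rep_angle of_angle
proof (rule equivpI)
  show "reflp (\<lambda>s t. \<exists>k::int. t = s + 2 * pi * of_int k)"
    by (rule reflpI) (auto intro: exI[of _ 0])
  show "symp (\<lambda>s t. \<exists>k::int. t = s + 2 * pi * of_int k)"
  proof (rule sympI, elim exE)
    fix s t :: real and k :: int
    assume "t = s + 2 * pi * of_int k"
    then have "s = t + 2 * pi * of_int (- k)" by simp
    then show "\<exists>k::int. s = t + 2 * pi * of_int k" ..
  qed
  show "transp (\<lambda>s t. \<exists>k::int. t = s + 2 * pi * of_int k)"
  proof (rule transpI, elim exE)
    fix r s t :: real and j k :: int
    assume "s = r + 2 * pi * of_int j" "t = s + 2 * pi * of_int k"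
    then have "t = r + 2 * pi * of_int (j + k)" by (simp add: algebra_simps)
    then show "\<exists>k::int. t = r + 2 * pi * of_int k" ..
  qed
qed

instantiation circle :: topological_space
begin

definition open_circle :: "circle set \<Rightarrow> bool" where
  "open_circle U \<longleftrightarrow> open (of_angle -` U)"

instance
  by standard (auto simp: open_circle_def vimage_Union vimage_Int)

end

text \<open>Arc-length (Haar) null sets: the negligible sets are the same for every Haar measure, and the
  preimage is a countable union of translates of its part in one period.\<close>

definition circle_null :: "circle set \<Rightarrow> bool" where
  "circle_null K \<longleftrightarrow> negligible (of_angle -` K)"

definition int_lattice :: "(real^2) set" where
  "int_lattice = {k. \<forall>i. k $ i \<in> \<int>}"

quotient_type torus = "real^2" / "\<lambda>x y. y - x \<in> int_lattice"
  morphisms rep_torus torus_proj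
proof (rule equivpI)
  show "reflp (\<lambda>x y. y - x \<in> int_lattice)"
    by (rule reflpI) (simp add: int_lattice_def)
  show "symp (\<lambda>x y. y - x \<in> int_lattice)"
  proof (rule sympI)
    fix x y :: "real^2"
    assume "y - x \<in> int_lattice"
    then have "- (y - x) \<in> int_lattice"
      unfolding int_lattice_def mem_Collect_eq vector_uminus_component by (blast intro: Ints_minus)
    then show "x - y \<in> int_lattice" by simp
  qed
  show "transp (\<lambda>x y. y - x \<in> int_lattice)"
  proof (rule transpI)
    fix x y z :: "real^2"
    assume "y - x \<in> int_lattice" "z - y \<in> int_lattice"
    then have "(z - y) + (y - x) \<in> int_lattice"
      unfolding int_lattice_def mem_Collect_eq vector_add_component by (blast intro: Ints_add)
    then show "z - x \<in> int_lattice" by simp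
  qed
qed

instantiation torus :: topological_space
begin

definition open_torus :: "torus set \<Rightarrow> bool" where
  "open_torus U \<longleftrightarrow> open (torus_proj -` U)"

instance
  by standard (auto simp: open_torus_def vimage_Union vimage_Int)

end

lift_definition torus_add :: "torus \<Rightarrow> real^2 \<Rightarrow> torus" is "(+)"
  by simp

lift_definition rotation :: "circle \<Rightarrow> real^2 \<Rightarrow> real^2" is
  "\<lambda>t x. vector [cos t * x $ 1 - sin t * x $ 2, sin t * x $ 1 + cos t * x $ 2]"
proof -
  fix s t :: real
  assume "\<exists>k::int. t = s + 2 * pi * of_int k"
  then have "cos t = cos s" "sin t = sin s"
    by (auto simp: cos_add sin_add)
  then show "(\<lambda>x::real^2. vector [cos s * x $ 1 - sin s * x $ 2, sin s * x $ 1 + cos s * x $ 2] :: real^2)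
           = (\<lambda>x. vector [cos t * x $ 1 - sin t * x $ 2, sin t * x $ 1 + cos t * x $ 2])"
    by simp
qed

definition properly_projected :: "(real^2) set \<Rightarrow> bool" where
  "properly_projected \<omega> \<longleftrightarrow> bounded \<omega> \<and> open \<omega> \<and> inj_on torus_proj (closure \<omega>)"

definition proper_angles :: "(real^2) set \<Rightarrow> circle set" where
  "proper_angles \<omega> = {\<theta>. properly_projected (rotation \<theta> ` \<omega>)}"


section \<open>Regular closed plane curves\<close>

text \<open>Here the choice of the representative of \<open>\<theta>\<close> is irrelevant, see \<open>circle_deriv_of_angle\<close>.\<close>

definition circle_deriv :: "(circle \<Rightarrow> real^2) \<Rightarrow> circle \<Rightarrow> real^2" where
  "circle_deriv \<gamma> \<theta> = vector_derivative (\<lambda>t. \<gamma> (of_angle t)) (at (rep_angle \<theta>))"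

lemma of_angle_eq_iff: "of_angle s = of_angle t \<longleftrightarrow> (\<exists>k::int. t = s + 2 * pi * of_int k)"
  using Quotient3_rel_abs[OF Quotient3_circle] circle.abs_eq_iff by simp

lemma of_angle_rep_angle [simp]: "of_angle (rep_angle \<theta>) = \<theta>"
  by (rule Quotient3_abs_rep[OF Quotient3_circle])

lemma circle_deriv_of_angle:
  "circle_deriv \<gamma> (of_angle t) = vector_derivative (\<lambda>s. \<gamma> (of_angle s)) (at t)"
proof -
  obtain k :: int where k: "rep_angle (of_angle t) = t + 2 * pi * of_int k"
    using of_angle_eq_iff[of t "rep_angle (of_angle t)"] by auto
  define c where "c = 2 * pi * of_int k"
  define g where "g = (\<lambda>s. \<gamma> (of_angle s))"
  have per: "g (s + c) = g s" for s
    unfolding g_def c_def using of_angle_eq_iff[of s "s + 2 * pi * of_int k"] by auto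
  have imp: "(g has_vector_derivative D) (at (a + d))"
    if D: "(g has_vector_derivative D) (at a)" and p: "\<And>s. g (s - d) = g s" for D a d
  proof -
    have "((g \<circ> (\<lambda>s. s - d)) has_vector_derivative (1 *\<^sub>R D)) (at (a + d))"
      by (rule vector_diff_chain_at) (use D in \<open>auto intro!: derivative_eq_intros\<close>)
    moreover have "g \<circ> (\<lambda>s. s - d) = g" using p by auto
    ultimately show ?thesis by simp
  qed
  have "(g has_vector_derivative D) (at (t + c)) \<longleftrightarrow> (g has_vector_derivative D) (at t)" for D
    using imp[of D "t + c" "- c"] imp[of D t c] per by (metis add_diff_cancel_right' diff_add_cancel diff_minus_eq_add
        add.right_neutral add_uminus_conv_diff)
  then have "vector_derivative g (at (t + c)) = vector_derivative g (at t)"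
    unfolding vector_derivative_def by simp
  then show ?thesis by (simp add: circle_deriv_def k g_def c_def)
qed

definition circle_differentiable :: "(circle \<Rightarrow> real^2) \<Rightarrow> bool" where
  "circle_differentiable \<gamma> \<longleftrightarrow> (\<forall>t. (\<lambda>s. \<gamma> (of_angle s)) differentiable (at t))"

definition C2_curve :: "(circle \<Rightarrow> real^2) \<Rightarrow> bool" where
  "C2_curve \<gamma> \<longleftrightarrow> circle_differentiable \<gamma> \<and> circle_differentiable (circle_deriv \<gamma>) \<and>
     continuous_on UNIV (circle_deriv (circle_deriv \<gamma>))"

text \<open>The \<open>else\<close> branch only serves the library's demand that a distance be nonnegative everywhere, also
  off the carrier.\<close>

definition C2_dist :: "(circle \<Rightarrow> real^2) \<Rightarrow> (circle \<Rightarrow> real^2) \<Rightarrow> real" where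
  "C2_dist \<gamma> \<delta> = (if C2_curve \<gamma> \<and> C2_curve \<delta> then
     (SUP \<theta>. dist (\<gamma> \<theta>) (\<delta> \<theta>)) + (SUP \<theta>. dist (circle_deriv \<gamma> \<theta>) (circle_deriv \<delta> \<theta>)) +
     (SUP \<theta>. dist (circle_deriv (circle_deriv \<gamma>) \<theta>) (circle_deriv (circle_deriv \<delta>) \<theta>))
     else 0)"

definition C2_topology :: "(circle \<Rightarrow> real^2) topology" where
  "C2_topology = Metric_space.mtopology (Collect C2_curve) C2_dist"

lemma continuous_of_angle: "continuous_on UNIV of_angle"
  by (simp add: continuous_on_open_vimage open_circle_def)

lemma compact_circle: "compact (UNIV :: circle set)"
proof -
  have "\<exists>s\<in>{0..2*pi}. of_angle s = \<theta>" for \<theta>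
  proof -
    define a where "a = rep_angle \<theta>"
    define s where "s = a + 2 * pi * of_int (- \<lfloor>a / (2*pi)\<rfloor>)"
    have "of_angle s = of_angle a" unfolding of_angle_eq_iff[of s a]
      by (rule exI[of _ "\<lfloor>a / (2*pi)\<rfloor>"]) (simp add: s_def)
    then have 1: "of_angle s = \<theta>" by (simp add: a_def)
    have "of_int \<lfloor>a / (2*pi)\<rfloor> * (2*pi) \<le> a" "a < (of_int \<lfloor>a / (2*pi)\<rfloor> + 1) * (2*pi)"
      by (simp_all add: floor_divide_lower floor_divide_upper)
    then have "s \<in> {0..2*pi}" by (simp add: s_def algebra_simps)
    with 1 show ?thesis by blast
  qed
  then have "UNIV = of_angle ` {0..2*pi}" by (auto simp: image_iff) metis
  then show ?thesis
    by (metis compact_Icc compact_continuous_image continuous_of_angle continuous_on_subset subset_UNIV)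
qed

lemma continuous_on_circleI:
  assumes "continuous_on UNIV (\<lambda>s. f (of_angle s))"
  shows "continuous_on UNIV f"
  using assms by (simp add: continuous_on_open_vimage open_circle_def vimage_def)

lemma circle_differentiable_imp_continuous:
  assumes "circle_differentiable \<gamma>"
  shows "continuous_on UNIV \<gamma>"
  using assms unfolding circle_differentiable_def
  by (intro continuous_on_circleI continuous_at_imp_continuous_on)
     (auto intro: differentiable_imp_continuous_within)

lemma bounded_circle:
  fixes f :: "circle \<Rightarrow> real^2"
  assumes "continuous_on UNIV f"
  shows "bounded (range f)"
  using assms compact_circle compact_continuous_image compact_imp_bounded by blast

lemma sup_dist_facts:
  fixes f g h :: "circle \<Rightarrow> real^2"
  assumes "bounded (range f)" "bounded (range g)" "bounded (range h)"
  shows "dist (f \<theta>) (g \<theta>) \<le> (SUP \<theta>. dist (f \<theta>) (g \<theta>))"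
    and "0 \<le> (SUP \<theta>. dist (f \<theta>) (g \<theta>))"
    and "(SUP \<theta>. dist (f \<theta>) (h \<theta>)) \<le> (SUP \<theta>. dist (f \<theta>) (g \<theta>)) + (SUP \<theta>. dist (g \<theta>) (h \<theta>))"
proof -
  have bdd: "bdd_above (range (\<lambda>\<theta>. dist (p \<theta>) (q \<theta>)))"
    if p: "bounded (range p)" and q: "bounded (range q)" for p q :: "circle \<Rightarrow> real^2"
  proof -
    obtain a b where "\<And>x. norm (p x) \<le> a" "\<And>x. norm (q x) \<le> b"
      using p q unfolding bounded_iff by blast
    then have "dist (p x) (q x) \<le> a + b" for x
      unfolding dist_norm by (meson add_mono norm_triangle_ineq4 order_trans)
    then show ?thesis by (auto simp: bdd_above_def)
  qed
  have up: "dist (p x) (q x) \<le> (SUP \<theta>. dist (p \<theta>) (q \<theta>))"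
    if "bounded (range p)" "bounded (range q)" for p q :: "circle \<Rightarrow> real^2" and x
    using bdd[OF that] by (intro cSUP_upper) auto
  show "dist (f \<theta>) (g \<theta>) \<le> (SUP \<theta>. dist (f \<theta>) (g \<theta>))" using up assms by blast
  then show "0 \<le> (SUP \<theta>. dist (f \<theta>) (g \<theta>))" using zero_le_dist order_trans by blast
  show "(SUP \<theta>. dist (f \<theta>) (h \<theta>)) \<le> (SUP \<theta>. dist (f \<theta>) (g \<theta>)) + (SUP \<theta>. dist (g \<theta>) (h \<theta>))"
  proof (rule cSUP_least)
    fix x :: circle
    have "dist (f x) (h x) \<le> dist (f x) (g x) + dist (g x) (h x)" by (rule dist_triangle)
    then show "dist (f x) (h x) \<le> (SUP \<theta>. dist (f \<theta>) (g \<theta>)) + (SUP \<theta>. dist (g \<theta>) (h \<theta>))"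
      using up[OF assms(1,2), of x] up[OF assms(2,3), of x] by linarith
  qed simp
qed

lemma C2_curve_bounded:
  assumes "C2_curve \<gamma>"
  shows "bounded (range \<gamma>)" "bounded (range (circle_deriv \<gamma>))"
    "bounded (range (circle_deriv (circle_deriv \<gamma>)))"
  using assms unfolding C2_curve_def
  by (blast intro: bounded_circle circle_differentiable_imp_continuous)+

lemma Metric_space_C2: "Metric_space (Collect C2_curve) C2_dist"
proof
  fix \<gamma> \<delta> :: "circle \<Rightarrow> real^2"
  show "C2_dist \<gamma> \<delta> = C2_dist \<delta> \<gamma>" by (simp add: C2_dist_def dist_commute)
next
  fix \<gamma> \<delta> assume "\<gamma> \<in> Collect C2_curve" "\<delta> \<in> Collect C2_curve"
  then have C: "C2_curve \<gamma>" "C2_curve \<delta>" by auto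
  note B = C2_curve_bounded[OF C(1)] C2_curve_bounded[OF C(2)]
  have nn: "0 \<le> (SUP \<theta>. dist (\<gamma> \<theta>) (\<delta> \<theta>))"
    "0 \<le> (SUP \<theta>. dist (circle_deriv \<gamma> \<theta>) (circle_deriv \<delta> \<theta>))"
    "0 \<le> (SUP \<theta>. dist (circle_deriv (circle_deriv \<gamma>) \<theta>) (circle_deriv (circle_deriv \<delta>) \<theta>))"
    using sup_dist_facts(2) B by blast+
  show "(C2_dist \<gamma> \<delta> = 0) = (\<gamma> = \<delta>)"
  proof
    assume "C2_dist \<gamma> \<delta> = 0"
    then have z: "(SUP \<theta>. dist (\<gamma> \<theta>) (\<delta> \<theta>)) = 0" using nn C unfolding C2_dist_def by simp
    have "dist (\<gamma> \<theta>) (\<delta> \<theta>) \<le> 0" for \<theta>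
      using sup_dist_facts(1)[OF B(1) B(4) B(4), of \<theta>] z by simp
    then show "\<gamma> = \<delta>" by auto
  qed (simp add: C2_dist_def)
next
  fix \<gamma> \<delta> \<epsilon>
  assume "\<gamma> \<in> Collect C2_curve" "\<delta> \<in> Collect C2_curve" "\<epsilon> \<in> Collect C2_curve"
  then have C: "C2_curve \<gamma>" "C2_curve \<delta>" "C2_curve \<epsilon>" by auto
  note B = C2_curve_bounded[OF C(1)] C2_curve_bounded[OF C(2)] C2_curve_bounded[OF C(3)]
  show "C2_dist \<gamma> \<epsilon> \<le> C2_dist \<gamma> \<delta> + C2_dist \<delta> \<epsilon>"
    using sup_dist_facts(3)[OF B(1) B(4) B(7)] sup_dist_facts(3)[OF B(2) B(5) B(8)]
      sup_dist_facts(3)[OF B(3) B(6) B(9)]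
    C unfolding C2_dist_def by simp
next
  fix \<gamma> \<delta> :: "circle \<Rightarrow> real^2"
  show "0 \<le> C2_dist \<gamma> \<delta>"
    unfolding C2_dist_def by (auto intro!: add_nonneg_nonneg sup_dist_facts(2) C2_curve_bounded)
qed

text \<open>The library's \<open>inside S\<close> is the union of the bounded components of the complement of \<open>S\<close>;
  for a simple closed curve there is exactly one such component, by the Jordan curve theorem.\<close>

definition enclosed :: "(circle \<Rightarrow> real^2) \<Rightarrow> (real^2) set" where
  "enclosed \<gamma> = inside (range \<gamma>)"

definition regular_curves :: "(circle \<Rightarrow> real^2) set" where
  "regular_curves = {\<gamma>. C2_curve \<gamma> \<and> inj \<gamma> \<and> properly_projected (enclosed \<gamma>) \<and>
     (\<forall>\<theta>. circle_deriv \<gamma> \<theta> \<noteq> 0)}"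

definition curvature :: "(circle \<Rightarrow> real^2) \<Rightarrow> circle \<Rightarrow> real" where
  "curvature \<gamma> \<theta> = (let v = circle_deriv \<gamma> \<theta>; a = circle_deriv (circle_deriv \<gamma>) \<theta> in
     sqrt ((norm a)\<^sup>2 * (norm v)\<^sup>2 - (a \<bullet> v)\<^sup>2) / (norm v) ^ 3)"


section \<open>Glancing lines, sides and order of contact\<close>

definition torus_line :: "torus \<Rightarrow> real^2 \<Rightarrow> torus set" where
  "torus_line z v = range (\<lambda>t. torus_add z (t *\<^sub>R v))"

definition line_direction :: "torus set \<Rightarrow> real^2 \<Rightarrow> bool" where
  "line_direction L v \<longleftrightarrow> norm v = 1 \<and> (\<exists>z. L = torus_line z v)"

definition glancing_line :: "torus set \<Rightarrow> torus set \<Rightarrow> bool" where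
  "glancing_line \<omega> L \<longleftrightarrow> (\<exists>v. line_direction L v) \<and> L \<inter> \<omega> = {} \<and> L \<inter> frontier \<omega> \<noteq> {}"

definition glancing_set :: "torus set \<Rightarrow> torus set" where
  "glancing_set \<omega> = {z \<in> frontier \<omega>. \<exists>L. glancing_line \<omega> L \<and> z \<in> L}"

definition one_sided :: "torus set \<Rightarrow> torus \<Rightarrow> real^2 \<Rightarrow> bool" where
  "one_sided \<omega> z v \<longleftrightarrow> (\<exists>U w \<epsilon>\<^sub>0. open U \<and> z \<in> U \<and> norm w = 1 \<and> v \<bullet> w = 0 \<and> \<epsilon>\<^sub>0 > 0 \<and>
     (\<forall>s. 0 < s \<and> s < \<epsilon>\<^sub>0 \<longrightarrow> torus_line (torus_add z (s *\<^sub>R w)) v \<inter> U \<inter> \<omega> = {}))"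

definition affine_chart :: "(torus \<Rightarrow> real^2) \<Rightarrow> torus set \<Rightarrow> bool" where
  "affine_chart \<psi> U \<longleftrightarrow> (\<exists>V f b. open V \<and> inj_on torus_proj V \<and> U = torus_proj ` V \<and>
     linear f \<and> bij f \<and> (\<forall>p\<in>V. \<psi> (torus_proj p) = f p + b))"

definition contact_outer :: "real \<Rightarrow> real \<Rightarrow> (real^2) set \<Rightarrow> (real^2) set" where
  "contact_outer \<eta> C\<^sub>o\<^sub>u\<^sub>t W = {q \<in> W. \<bar>q $ 2\<bar> powr \<eta> \<le> C\<^sub>o\<^sub>u\<^sub>t * \<bar>q $ 1\<bar>}"

definition contact_inner :: "real \<Rightarrow> real \<Rightarrow> (real^2) set \<Rightarrow> (real^2) set" where
  "contact_inner \<eta> C\<^sub>i\<^sub>n W =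
     {q \<in> W - {0}. inverse C\<^sub>i\<^sub>n * \<bar>q $ 2\<bar> powr \<eta> \<le> \<bar>q $ 1\<bar> \<and> \<bar>q $ 1\<bar> \<le> C\<^sub>i\<^sub>n * \<bar>q $ 2\<bar> powr \<eta>}"

text \<open>A line determines its direction up to sign, and \<open>one_sided\<close> does not depend on that sign.\<close>

definition has_order :: "torus set \<Rightarrow> torus set \<Rightarrow> torus \<Rightarrow> real \<Rightarrow> bool" where
  "has_order \<omega> L z \<eta> \<longleftrightarrow> \<eta> > 0 \<and> glancing_line \<omega> L \<and> z \<in> frontier \<omega> \<inter> L \<and>
    (\<forall>v. line_direction L v \<longrightarrow>
      (\<exists>\<psi> U C\<^sub>i\<^sub>n C\<^sub>o\<^sub>u\<^sub>t. affine_chart \<psi> U \<and> z \<in> U \<and> \<psi> z = 0 \<and>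
        \<psi> ` (L \<inter> U) = {q \<in> \<psi> ` U. q $ 1 = 0} \<and> C\<^sub>o\<^sub>u\<^sub>t > C\<^sub>i\<^sub>n \<and> C\<^sub>i\<^sub>n > 1 \<and>
        (let F = contact_inner \<eta> C\<^sub>i\<^sub>n (\<psi> ` U); \<Omega> = contact_outer \<eta> C\<^sub>o\<^sub>u\<^sub>t (\<psi> ` U); D = \<psi> ` (\<omega> \<inter> U) in
          if one_sided \<omega> z v
          then F \<inter> {q. q $ 1 \<ge> 0 \<and> q $ 2 \<ge> 0} \<subseteq> D \<and> D \<subseteq> \<Omega> \<inter> {q. q $ 1 \<ge> 0}
          else F \<inter> {q. q $ 2 \<ge> 0} \<subseteq> D \<and> D \<subseteq> \<Omega> \<or>
               F \<inter> {q. q $ 1 * q $ 2 \<ge> 0} \<subseteq> D \<and> D \<subseteq> \<Omega>)))"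

end

theory Submission
  imports Defs
begin

text \<open>A glancing line can only have one of finitely many directions, and it supports the region, so that a
glancing point is a point where the tangent has one of these directions; rotating the curve a
little makes the curvature nonzero at all such points.

Let \<open>p\<close> be a point of the curve on a glancing line \<open>L\<close> with direction \<open>v\<close>. By the Jordan curve theorem the
enclosed region \<open>E\<close> is connected, and it misses every lift of \<open>L\<close> to the plane. Hence \<open>E\<close> lies strictly on one
side of the line through \<open>p\<close>, say \<open>(x - p) \<bullet> n > 0\<close> with a unit normal \<open>n\<close> of \<open>v\<close>
(\<open>avoiding_region_halfplane\<close>), and no lift separates two points of \<open>E\<close>. The second fact says that the
subgroup \<open>{k \<bullet> n | k integral}\<close> of the reals has no element strictly between \<open>0\<close> and the width \<open>W\<close> of \<open>E\<close> in
direction \<open>n\<close>. It is therefore cyclic with a generator \<open>g \<ge> W\<close>, so that \<open>n = g a\<close> for an integer vector \<open>a\<close>, and \<open>v\<close> is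
parallel to an integer vector of length at most \<open>1 / W\<close> (\<open>lattice_gap_imp_integer_direction\<close>). The first
fact says that \<open>(\<gamma> - p) \<bullet> n\<close> has a minimum at \<open>p\<close>, so the curve is tangent to \<open>v\<close> there
(\<open>glancing_tangent_integer_direction\<close>).

The set \<open>nondegenerate_curves\<close> collects the regular curves that are curved at each point whose tangent is
parallel to an integer vector of length at most \<open>1 / r\<close>, for some \<open>r\<close> below the width of the curve. It is open
because finitely many integer vectors matter and each condition is the positivity of a continuous
function on the compact circle. For a rotated curve the condition fails exactly when the angle of an integer vector
minus the angle of rotation is, modulo \<open>\<pi>\<close>, a critical value of the tangent angle of the original curve. The
tangent angle is continuously differentiable, so by Sard's theorem these rotations form a compact null set
(\<open>degenerate_rotations_null\<close>). Density follows, because small rotations are close to the identity in the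
\<open>C\<^sup>2\<close> metric and keep the region properly projected.

At a glancing point with nonzero curvature the curve is, in coordinates along and across the line, the graph of a function
\<open>f\<close> comparable to \<open>y\<^sup>2\<close>, and \<open>E\<close> is locally the set above this graph: a small box minus the graph has
two connected pieces, the lower one contains points outside the supporting half-plane, and the upper one must
then meet \<open>E\<close> (\<open>open_set_above_frontier_graph\<close>). On the torus no translate of \<open>E\<close> comes near \<open>p\<close>, since
the projection is injective on the closure of \<open>E\<close>, and no other lift of \<open>L\<close> comes near \<open>p\<close>, by the gap above. So every
such point is one-sided, and scaling the coordinate across the line so that \<open>f\<close> behaves like
\<open>y\<^sup>2 / 4\<close> gives order \<open>2\<close> with the constants \<open>2\<close> and \<open>8\<close> (\<open>curved_glancing_point_has_order_2\<close>).\<close>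

section \<open>The lattice and the covering map\<close>

lemma int_lattice_0 [simp]: "0 \<in> int_lattice"
  by (simp add: int_lattice_def)

lemma int_lattice_minus [simp]: "- k \<in> int_lattice \<longleftrightarrow> k \<in> int_lattice"
  by (simp add: int_lattice_def)

lemma int_lattice_diff: "k \<in> int_lattice \<Longrightarrow> l \<in> int_lattice \<Longrightarrow> k - l \<in> int_lattice"
  by (simp add: int_lattice_def)

lemma int_lattice_scale: "k \<in> int_lattice \<Longrightarrow> a \<in> \<int> \<Longrightarrow> a *\<^sub>R k \<in> int_lattice"
  by (simp add: int_lattice_def)

lemma norm_int_lattice_ge_1:
  assumes "k \<in> int_lattice" "k \<noteq> 0"
  shows "1 \<le> norm k"
proof -
  obtain i where "k $ i \<noteq> 0" using assms(2) by (metis vec_eq_iff zero_index)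
  then have "1 \<le> \<bar>k $ i\<bar>" using assms(1) by (simp add: int_lattice_def Ints_nonzero_abs_ge1)
  then show ?thesis using component_le_norm_cart[of k i] by linarith
qed

lemma finite_bounded_int_lattice:
  assumes "bounded S"
  shows "finite (int_lattice \<inter> S)"
proof -
  obtain B where B: "\<And>x. x \<in> S \<Longrightarrow> norm x \<le> B" using assms unfolding bounded_iff by blast
  have "int_lattice \<inter> S \<subseteq> (\<lambda>(i, j). vector [of_int i, of_int j]) ` ({-\<lceil>B\<rceil>..\<lceil>B\<rceil>} \<times> {-\<lceil>B\<rceil>..\<lceil>B\<rceil>})"
  proof
    fix k assume k: "k \<in> int_lattice \<inter> S"
    then have "k $ 1 \<in> \<int>" "k $ 2 \<in> \<int>" by (auto simp: int_lattice_def)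
    then obtain i j where ij: "k $ 1 = of_int i" "k $ 2 = of_int j" by (elim Ints_cases)
    have "\<bar>k $ 1\<bar> \<le> B" "\<bar>k $ 2\<bar> \<le> B"
      using component_le_norm_cart[of k] B k by (meson IntD2 order_trans)+
    then have "i \<in> {-\<lceil>B\<rceil>..\<lceil>B\<rceil>}" "j \<in> {-\<lceil>B\<rceil>..\<lceil>B\<rceil>}"
      using ij by (auto simp: abs_le_iff; linarith)+
    moreover have "k = vector [of_int i, of_int j]"
      by (simp add: vec_eq_iff forall_2 ij)
    ultimately show "k \<in> (\<lambda>(i, j). vector [of_int i, of_int j]) ` ({-\<lceil>B\<rceil>..\<lceil>B\<rceil>} \<times> {-\<lceil>B\<rceil>..\<lceil>B\<rceil>})"
      by (intro image_eqI[of _ _ "(i, j)"]) auto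
  qed
  then show ?thesis by (rule finite_subset) simp
qed

lemma closed_int_lattice:
  assumes "S \<subseteq> int_lattice"
  shows "closed S"
proof (rule discrete_imp_closed[of 1])
  show "\<forall>x\<in>S. \<forall>y\<in>S. dist y x < 1 \<longrightarrow> y = x"
  proof (intro ballI impI)
    fix x y assume "x \<in> S" "y \<in> S" "dist y x < 1"
    then show "y = x"
      using norm_int_lattice_ge_1[of "y - x"] int_lattice_diff[of y x] assms
      by (force simp: dist_norm)
  qed
qed simp

lemma torus_proj_eq_iff: "torus_proj x = torus_proj y \<longleftrightarrow> y - x \<in> int_lattice"
  using torus.abs_eq_iff by simp

lemma torus_proj_rep_torus [simp]: "torus_proj (rep_torus z) = z"
  by (rule Quotient3_abs_rep[OF Quotient3_torus])

lemma torus_add_proj: "torus_add (torus_proj x) v = torus_proj (x + v)"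
  by (rule torus_add.abs_eq)

lemma open_torus_proj_vimage: "open U \<Longrightarrow> open (torus_proj -` U)"
  by (simp add: open_torus_def)

lemma vimage_torus_proj_image: "torus_proj -` torus_proj ` S = (\<Union>k\<in>int_lattice. (+) k ` S)"
proof (intro equalityI subsetI)
  fix x assume "x \<in> torus_proj -` torus_proj ` S"
  then obtain y where "y \<in> S" "x - y \<in> int_lattice" by (auto simp: torus_proj_eq_iff) (metis torus_proj_eq_iff)
  then show "x \<in> (\<Union>k\<in>int_lattice. (+) k ` S)" by (auto intro!: bexI[of _ "x - y"] image_eqI[of _ _ y])
next
  fix x assume "x \<in> (\<Union>k\<in>int_lattice. (+) k ` S)"
  then obtain k y where "k \<in> int_lattice" "y \<in> S" "x = k + y" by auto
  then have "torus_proj x = torus_proj y"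
    using int_lattice_minus[of k] by (simp add: torus_proj_eq_iff)
  with \<open>y \<in> S\<close> show "x \<in> torus_proj -` torus_proj ` S" by auto
qed

lemma open_torus_proj_image: "open V \<Longrightarrow> open (torus_proj ` V)"
  unfolding open_torus_def vimage_torus_proj_image by (intro open_UN ballI open_translation)

text \<open>The full preimage is the sum of the discrete closed lattice and a compact set, hence closed.\<close>

lemma closed_torus_proj_image:
  assumes "compact S"
  shows "closed (torus_proj ` S)"
proof -
  have "torus_proj -` torus_proj ` S = (\<Union>k\<in>int_lattice. \<Union>y\<in>S. {k + y})"
    unfolding vimage_torus_proj_image by auto
  moreover have "closed (\<Union>k\<in>int_lattice. \<Union>y\<in>S. {k + y})"
    by (rule closed_compact_sums[OF closed_int_lattice assms]) simp
  ultimately show ?thesis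
    by (metis closed_def open_torus_def vimage_Compl)
qed

text \<open>Injectivity on the closure keeps the projections of the region and of its boundary disjoint; without it, a
translate of the region could cover part of the boundary.\<close>

lemma frontier_torus_proj_image:
  assumes "open S" "bounded S" "inj_on torus_proj (closure S)"
  shows "frontier (torus_proj ` S) = torus_proj ` frontier S"
proof -
  have comp: "compact (closure S)" using assms(2) by (simp add: compact_closure)
  have 1: "closure (torus_proj ` S) = torus_proj ` closure S"
  proof
    show "closure (torus_proj ` S) \<subseteq> torus_proj ` closure S"
      by (meson closed_torus_proj_image closure_minimal closure_subset comp image_mono)
    show "torus_proj ` closure S \<subseteq> closure (torus_proj ` S)"
    proof clarify
      fix x assume x: "x \<in> closure S"
      have "torus_proj x \<notin> T" if T: "open T" "T \<inter> torus_proj ` S = {}" for T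
      proof
        assume "torus_proj x \<in> T"
        then have "torus_proj -` T \<inter> S \<noteq> {}"
          using x open_torus_proj_vimage[OF T(1)] open_Int_closure_eq_empty[of "torus_proj -` T" S] by blast
        with T(2) show False by blast
      qed
      from this[of "- closure (torus_proj ` S)"] show "torus_proj x \<in> closure (torus_proj ` S)"
        using closure_subset[of "torus_proj ` S"] by auto
    qed
  qed
  have 2: "interior (torus_proj ` S) = torus_proj ` S"
    using open_torus_proj_image[OF assms(1)] by (rule interior_open)
  have "torus_proj ` closure S - torus_proj ` S = torus_proj ` (closure S - S)"
    using assms(3) closure_subset[of S] by (simp add: inj_on_image_set_diff)
  then show ?thesis unfolding frontier_def 1 2 using assms(1) by (simp add: interior_open)
qed

section \<open>The region enclosed by a simple closed curve in the plane\<close>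

lemma linear_inv_bij:
  assumes "linear f" "bij f"
  shows "linear (inv f)"
proof (rule linearI)
  show "inv f (x + y) = inv f x + inv f y" for x y
    by (rule inv_f_eq) (use assms in \<open>simp_all add: bij_is_inj linear_add bij_inv_eq_iff bij_is_surj surj_f_inv_f\<close>)
  show "inv f (c *\<^sub>R x) = c *\<^sub>R inv f x" for c x
    by (rule inv_f_eq) (use assms in \<open>simp_all add: bij_is_inj linear_cmul bij_is_surj surj_f_inv_f\<close>)
qed

lemma inside_bij_linear_image:
  fixes f :: "'a::euclidean_space \<Rightarrow> 'b::euclidean_space"
  assumes "linear f" "bij f"
  shows "inside (f ` S) = f ` inside S"
proof -
  define g where "g = inv f"
  have fg: "f (g y) = y" and gf: "g (f x) = x" for x y
    using assms(2) by (simp_all add: g_def bij_is_surj surj_f_inv_f bij_is_inj)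
  have lg: "linear g" unfolding g_def
    using assms by (rule linear_inv_bij)
  have mg: "f ` T = g -` T" for T using fg gf by (auto simp: image_iff) metis+
  have c: "f ` (- T) = - f ` T" for T unfolding mg by auto
  have homeo: "homeomorphism (- S) (- f ` S) f g"
    unfolding c[symmetric]
    by (rule homeomorphismI) (auto simp: gf fg linear_continuous_on linear_conv_bounded_linear[symmetric] assms(1) lg)
  have bd: "bounded (f ` T) \<longleftrightarrow> bounded T" for T
  proof
    assume "bounded (f ` T)"
    then have "bounded (g ` f ` T)" by (rule bounded_linear_image) (use lg linear_conv_bounded_linear in blast)
    then show "bounded T" by (simp add: image_image gf)
  next
    assume "bounded T"
    then show "bounded (f ` T)" by (rule bounded_linear_image) (use assms(1) linear_conv_bounded_linear in blast)
  qed
  have inj: "f x \<in> f ` T \<longleftrightarrow> x \<in> T" for x T using gf by (auto simp: image_iff) metis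
  have *: "f x \<in> inside (f ` S) \<longleftrightarrow> x \<in> inside S" for x
  proof (cases "x \<in> S")
    case False
    then have "connected_component_set (- f ` S) (f x) = f ` connected_component_set (- S) x"
      by (intro connected_component_set_homeomorphism[OF homeo]) simp
    with False show ?thesis unfolding inside_def by (simp add: bd inj)
  qed (simp add: inside_def inj)
  show ?thesis
    using * inj fg by (metis (no_types, lifting) image_iff subsetI subset_antisym)
qed

text \<open>The identification with the complex plane gives access to the Jordan curve theorem and to
polar coordinates.\<close>

definition plane_to_complex :: "real^2 \<Rightarrow> complex" where
  "plane_to_complex x = Complex (x $ 1) (x $ 2)"

lemma linear_plane_to_complex: "linear plane_to_complex"
  by (rule linearI) (simp_all add: plane_to_complex_def complex_eq_iff)

lemma bij_plane_to_complex: "bij plane_to_complex"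
proof (rule bijI')
  fix x y show "(plane_to_complex x = plane_to_complex y) = (x = y)"
    by (simp add: plane_to_complex_def vec_eq_iff forall_2)
next
  fix z show "\<exists>x. z = plane_to_complex x"
    by (rule exI[of _ "vector [Re z, Im z]"]) (simp add: plane_to_complex_def)
qed

lemma range_of_angle_period:
  shows "range f = (\<lambda>t. f (of_angle (2 * pi * t))) ` {0..1}"
proof -
  have "\<exists>t\<in>{0..1}. of_angle (2 * pi * t) = \<theta>" for \<theta>
  proof -
    define a where "a = rep_angle \<theta> / (2 * pi)"
    have "of_angle (2 * pi * frac a) = of_angle (rep_angle \<theta>)"
      unfolding of_angle_eq_iff
      by (rule exI[of _ "\<lfloor>a\<rfloor>"]) (simp add: frac_def a_def algebra_simps)
    moreover have "frac a \<in> {0..1}" using frac_lt_1[of a] by simp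
    ultimately show ?thesis by auto
  qed
  then show ?thesis by (auto simp: image_iff) metis
qed

lemma of_angle_eq_imp_eq:
  assumes "of_angle s = of_angle t" "\<bar>t - s\<bar> < 2 * pi"
  shows "s = t"
proof -
  obtain k :: int where k: "t = s + 2 * pi * of_int k" using assms(1) of_angle_eq_iff by blast
  with assms(2) have "\<bar>2 * pi * of_int k\<bar> < 2 * pi * 1" by simp
  then have "\<bar>of_int k :: real\<bar> < 1" by (simp add: abs_mult)
  then have "k = 0" by linarith
  with k show ?thesis by simp
qed

lemma Jordan_enclosed:
  assumes "continuous_on UNIV \<gamma>" "inj \<gamma>"
  shows "enclosed \<gamma> \<noteq> {}" "open (enclosed \<gamma>)" "connected (enclosed \<gamma>)" "bounded (enclosed \<gamma>)"
    "frontier (enclosed \<gamma>) = range \<gamma>"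
proof -
  let ?h = plane_to_complex
  note L = linear_plane_to_complex and B = bij_plane_to_complex
  define c where "c = (\<lambda>t. ?h (\<gamma> (of_angle (2 * pi * t))))"
  have cont_h: "continuous_on S ?h" for S
    using L by (simp add: linear_continuous_on linear_conv_bounded_linear[symmetric])
  have "continuous_on UNIV (\<lambda>t. of_angle (2 * pi * t))"
    by (rule continuous_on_compose2[OF continuous_of_angle]) (auto intro!: continuous_intros)
  then have "continuous_on UNIV (\<lambda>t. \<gamma> (of_angle (2 * pi * t)))"
    by (rule continuous_on_compose2[OF assms(1)]) auto
  then have contc: "continuous_on UNIV c" unfolding c_def
    by (rule continuous_on_compose2[OF cont_h]) auto
  have range: "path_image c = ?h ` range \<gamma>"
    unfolding path_image_def c_def range_of_angle_period[of \<gamma>] by (auto simp: image_image)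
  have "simple_path c"
    unfolding simple_path_def loop_free_def path_def
  proof (intro conjI ballI impI)
    show "continuous_on {0..1} c" using contc continuous_on_subset by blast
  next
    fix x y :: real assume xy: "x \<in> {0..1}" "y \<in> {0..1}" "c x = c y"
    then have eq: "of_angle (2 * pi * x) = of_angle (2 * pi * y)"
      using B assms(2) unfolding c_def by (metis bij_is_inj injD)
    show "x = y \<or> x = 0 \<and> y = 1 \<or> x = 1 \<and> y = 0"
    proof (cases "\<bar>y - x\<bar> < 1")
      case True
      then have "\<bar>2 * pi * y - 2 * pi * x\<bar> < 2 * pi"
        by (simp add: right_diff_distrib[symmetric] abs_mult)
      from of_angle_eq_imp_eq[OF eq this] show ?thesis by simp
    qed (use xy in auto)
  qed
  moreover have "pathfinish c = pathstart c"
    using of_angle_eq_iff[of 0 "2*pi"] by (auto simp: pathfinish_def pathstart_def c_def intro!: arg_cong[of _ _ \<gamma>] arg_cong[of _ _ ?h] exI[of _ "1::int"])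
  ultimately have J: "inside (path_image c) \<noteq> {}" "open (inside (path_image c))" "connected (inside (path_image c))"
     "bounded (inside (path_image c))" "frontier (inside (path_image c)) = path_image c"
    using Jordan_inside_outside[of c] by blast+
  define g where "g = inv ?h"
  have gh: "g (?h x) = x" for x using B by (simp add: g_def bij_is_inj)
  have lg: "linear g" unfolding g_def
    using L B by (rule linear_inv_bij)
  have bg: "bij g" unfolding g_def using B by (simp add: bij_imp_bij_inv)
  have E: "enclosed \<gamma> = g ` inside (path_image c)"
    unfolding enclosed_def range inside_bij_linear_image[OF L B] by (simp add: image_image gh)
  show "enclosed \<gamma> \<noteq> {}" using J(1) E by simp
  show "open (enclosed \<gamma>)" unfolding E
    using open_bijective_linear_image_eq[OF lg bg] J(2) by blast
  show "connected (enclosed \<gamma>)" unfolding E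
    by (rule connected_continuous_image[OF _ J(3)]) (use lg in \<open>simp add: linear_continuous_on linear_conv_bounded_linear[symmetric]\<close>)
  show "bounded (enclosed \<gamma>)" unfolding E
    by (rule bounded_linear_image[OF J(4)]) (use lg linear_conv_bounded_linear in blast)
  have "frontier (enclosed \<gamma>) = g ` frontier (inside (path_image c))" unfolding E frontier_def
    using closure_bounded_linear_image_subset[of g] interior_bijective_linear_image[OF lg bg]
      closure_injective_linear_image[OF lg bij_is_inj[OF bg]]
    by (simp add: image_set_diff[OF bij_is_inj[OF bg]])
  then show "frontier (enclosed \<gamma>) = range \<gamma>" using J(5) by (simp add: range image_image gh)
qed

section \<open>Lines on the torus that avoid a connected region\<close>

text \<open>Rotation by a right angle; thus \<open>perp u \<bullet> v\<close> is the determinant of the pair \<open>u, v\<close>.\<close>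

definition perp :: "real^2 \<Rightarrow> real^2" where
  "perp v = vector [- v $ 2, v $ 1]"

lemma linear_perp: "linear perp"
  by (rule linearI) (simp_all add: perp_def vec_eq_iff forall_2)

lemma perp_diff: "perp (u - v) = perp u - perp v"
  by (rule linear_diff[OF linear_perp])

lemma inner_2: "x \<bullet> y = x $ 1 * y $ 1 + x $ 2 * y $ 2" for x y :: "real^2"
  by (simp add: inner_vec_def sum_2)

lemma norm_perp [simp]: "norm (perp v) = norm v"
  by (simp add: norm_eq_sqrt_inner inner_2 perp_def algebra_simps)

lemma perp_in_int_lattice: "k \<in> int_lattice \<Longrightarrow> perp k \<in> int_lattice"
  by (simp add: int_lattice_def perp_def forall_2)

lemma unit_normal_eq_perp:
  assumes "norm v = 1" "norm n = 1" "n \<bullet> v = 0"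
  shows "n = perp v \<or> n = - perp v"
proof -
  have v: "v $ 1 * v $ 1 + v $ 2 * v $ 2 = 1"
    using assms(1) by (simp add: norm_eq_sqrt_inner inner_2)
  have o: "n $ 1 * v $ 1 + n $ 2 * v $ 2 = 0"
    using assms(3) by (simp add: inner_2)
  define c where "c = n \<bullet> perp v"
  have "n = c *\<^sub>R perp v"
    unfolding vec_eq_iff forall_2 c_def
    using v o by (simp add: inner_2 perp_def) algebra
  moreover from this have "\<bar>c\<bar> = 1" using assms by (metis mult.right_neutral norm_perp norm_scaleR)
  ultimately show ?thesis by (metis abs_1 abs_eq_iff scaleR_minus_left scaleR_one)
qed

lemma orthonormal_expansion:
  fixes v n x :: "real^2"
  assumes "norm v = 1" "norm n = 1" "n \<bullet> v = 0"
  shows "x = (x \<bullet> v) *\<^sub>R v + (x \<bullet> n) *\<^sub>R n"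
proof -
  have v: "v $ 1 * v $ 1 + v $ 2 * v $ 2 = 1"
    using assms(1) by (simp add: norm_eq_sqrt_inner inner_2)
  have "x = (x \<bullet> v) *\<^sub>R v + (x \<bullet> perp v) *\<^sub>R perp v"
    unfolding vec_eq_iff forall_2 using v by (simp add: inner_2 perp_def) algebra
  then show ?thesis using unit_normal_eq_perp[OF assms] by auto
qed

lemma mem_torus_line_proj:
  "torus_proj x \<in> torus_line (torus_proj p) v \<longleftrightarrow> (\<exists>t. \<exists>k\<in>int_lattice. x = p + t *\<^sub>R v + k)"
proof
  assume "torus_proj x \<in> torus_line (torus_proj p) v"
  then obtain t where "torus_proj (p + t *\<^sub>R v) = torus_proj x"
    by (auto simp: torus_line_def torus_add_proj)
  then have "x - (p + t *\<^sub>R v) \<in> int_lattice" by (simp add: torus_proj_eq_iff)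
  then show "\<exists>t. \<exists>k\<in>int_lattice. x = p + t *\<^sub>R v + k"
    by (intro exI[of _ t] bexI[of _ "x - (p + t *\<^sub>R v)"]) auto
next
  assume "\<exists>t. \<exists>k\<in>int_lattice. x = p + t *\<^sub>R v + k"
  then obtain t k where k: "k \<in> int_lattice" "x = p + t *\<^sub>R v + k" by blast
  then have "torus_proj x = torus_add (torus_proj p) (t *\<^sub>R v)"
    unfolding torus_add_proj torus_proj_eq_iff using int_lattice_minus[of k] by simp
  then show "torus_proj x \<in> torus_line (torus_proj p) v" by (simp add: torus_line_def)
qed

lemma torus_line_through:
  assumes "line_direction L v" "z \<in> L"
  shows "L = torus_line z v"
proof -
  obtain z0 where L: "L = torus_line z0 v" using assms(1) by (auto simp: line_direction_def)
  define p where "p = rep_torus z0"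
  have z0: "z0 = torus_proj p" by (simp add: p_def)
  obtain t where z: "z = torus_proj (p + t *\<^sub>R v)"
    using assms(2) by (auto simp: L torus_line_def z0 torus_add_proj)
  have "torus_add z0 (s *\<^sub>R v) = torus_add z ((s - t) *\<^sub>R v)" for s
    unfolding z0 z torus_add_proj by (simp add: algebra_simps)
  moreover have "torus_add z (s *\<^sub>R v) = torus_add z0 ((s + t) *\<^sub>R v)" for s
    unfolding z0 z torus_add_proj by (simp add: algebra_simps)
  ultimately show ?thesis unfolding L torus_line_def by (metis (no_types, lifting) image_subset_iff rangeI subset_antisym)
qed

text \<open>The level sets \<open>(x - p) \<bullet> n = k \<bullet> n\<close> are the lifts of the torus line to the plane.\<close>

lemma avoided_line_level:
  assumes "torus_line (torus_proj p) v \<inter> torus_proj ` E = {}"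
    and "norm v = 1" "norm n = 1" "n \<bullet> v = 0" "x \<in> E" "k \<in> int_lattice"
  shows "(x - p) \<bullet> n \<noteq> k \<bullet> n"
proof
  assume "(x - p) \<bullet> n = k \<bullet> n"
  then have "(x - p - k) \<bullet> n = 0" by (simp add: inner_diff_left)
  with orthonormal_expansion[OF assms(2-4), of "x - p - k"]
  have "x - p - k = ((x - p - k) \<bullet> v) *\<^sub>R v" by simp
  then have "x = p + ((x - p - k) \<bullet> v) *\<^sub>R v + k" by (metis add.commute add_diff_eq diff_add_cancel)
  then have "torus_proj x \<in> torus_line (torus_proj p) v"
    unfolding mem_torus_line_proj using assms(6) by blast
  with assms(1,5) show False by blast
qed

lemma avoiding_region_halfplane:
  assumes "torus_line (torus_proj p) v \<inter> torus_proj ` E = {}" "norm v = 1" "connected E"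
  obtains n where "norm n = 1" "n \<bullet> v = 0" "\<And>x. x \<in> E \<Longrightarrow> (x - p) \<bullet> n > 0"
proof -
  have n: "norm (perp v) = 1" "perp v \<bullet> v = 0" using assms(2) by (simp_all add: inner_2) (simp add: perp_def)
  have ne: "(x - p) \<bullet> perp v \<noteq> 0" if "x \<in> E" for x
    using avoided_line_level[OF assms(1,2) n that int_lattice_0] by simp
  have "(\<forall>x\<in>E. (x - p) \<bullet> perp v > 0) \<or> (\<forall>x\<in>E. (x - p) \<bullet> perp v < 0)"
  proof (rule ccontr)
    assume "\<not> ?thesis"
    then obtain x y where "x \<in> E" "y \<in> E" "perp v \<bullet> x \<le> perp v \<bullet> p" "perp v \<bullet> p \<le> perp v \<bullet> y"
      by (auto simp: not_less inner_diff_left inner_diff_right inner_commute)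
    then obtain z where "z \<in> E" "perp v \<bullet> z = perp v \<bullet> p"
      using connected_ivt_hyperplane[OF assms(3)] by blast
    with ne[of z] show False by (simp add: inner_diff_left inner_diff_right inner_commute)
  qed
  then show thesis
  proof
    assume "\<forall>x\<in>E. (x - p) \<bullet> perp v > 0"
    with n that show thesis by blast
  next
    assume "\<forall>x\<in>E. (x - p) \<bullet> perp v < 0"
    with n that[of "- perp v"] show thesis by simp
  qed
qed

text \<open>If the inequalities held, the lift through \<open>p + k\<close> would have points of the connected region near \<open>p\<close> on one
side and near \<open>q\<close> on the other, and so would meet the region.\<close>

lemma avoiding_region_gap:
  assumes "torus_line (torus_proj p) v \<inter> torus_proj ` E = {}" "norm v = 1" "connected E"
    and "norm n = 1" "n \<bullet> v = 0" "p \<in> closure E" "q \<in> closure E" "k \<in> int_lattice"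
  shows "\<not> (0 < k \<bullet> n \<and> k \<bullet> n < (q - p) \<bullet> n)"
proof
  assume k: "0 < k \<bullet> n \<and> k \<bullet> n < (q - p) \<bullet> n"
  let ?c = "n \<bullet> p + k \<bullet> n"
  have "{x. n \<bullet> x < ?c} \<inter> E \<noteq> {}" "{x. n \<bullet> x > ?c} \<inter> E \<noteq> {}"
  proof -
    have "n \<bullet> p < ?c" "n \<bullet> q > ?c" using k by (simp_all add: inner_diff_left inner_diff_right inner_commute)
    then show "{x. n \<bullet> x < ?c} \<inter> E \<noteq> {}" "{x. n \<bullet> x > ?c} \<inter> E \<noteq> {}"
      using assms(6,7) open_Int_closure_eq_empty[OF open_halfspace_lt[of n ?c], of E]
        open_Int_closure_eq_empty[OF open_halfspace_gt[of ?c n], of E] by blast+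
  qed
  then obtain x y where "x \<in> E" "y \<in> E" "n \<bullet> x < ?c" "?c < n \<bullet> y" by blast
  then have "x \<in> E" "y \<in> E" "n \<bullet> x \<le> ?c" "?c \<le> n \<bullet> y" by auto
  then obtain z where "z \<in> E" "n \<bullet> z = ?c"
    using connected_ivt_hyperplane[OF assms(3)] by blast
  with avoided_line_level[OF assms(1,2,4,5) _ assms(8), of z] show False
    by (simp add: inner_diff_left inner_diff_right inner_commute)
qed

text \<open>The values \<open>k \<bullet> n\<close> form a subgroup of the reals. A gap next to \<open>0\<close> forces it to be cyclic, generated by some
\<open>g \<ge> W\<close>. Since the coordinates of \<open>n\<close> belong to it, \<open>n = g a\<close> with \<open>a\<close> integral, and \<open>perp a\<close> is the required
vector, of length \<open>1 / g\<close>.\<close>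

lemma lattice_gap_imp_integer_direction:
  assumes n: "norm n = 1" and W: "0 < W"
    and gap: "\<And>k. k \<in> int_lattice \<Longrightarrow> \<not> (0 < k \<bullet> n \<and> k \<bullet> n < W)"
  obtains m where "m \<in> int_lattice" "m \<noteq> 0" "m \<bullet> n = 0" "norm m * W \<le> 1"
proof -
  define G where "G = {k \<bullet> n | k. k \<in> int_lattice \<and> 0 < k \<bullet> n}"
  have G_ge: "W \<le> g" if "g \<in> G" for g using gap that by (force simp: G_def not_less)
  have e: "axis i 1 \<in> int_lattice" for i :: 2 by (simp add: int_lattice_def axis_def)
  have en: "axis i 1 \<bullet> n = n $ i" for i by (simp add: inner_axis' )
  have "n \<noteq> 0" using n by auto
  then obtain i where i: "n $ i \<noteq> 0" by (metis vec_eq_iff zero_index)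
  then have "\<bar>n $ i\<bar> \<in> G"
    using e[of i] en[of i] unfolding G_def mem_Collect_eq
    by (cases "n $ i > 0") (rule exI[of _ "axis i 1"], simp, rule exI[of _ "- axis i 1"], simp)
  then have G0: "G \<noteq> {}" by blast
  have bdd: "bdd_below G" using G_ge by (meson bdd_belowI)
  \<comment> \<open>Two distinct values differ by at least \<open>W\<close>, so a value closer than \<open>W\<close> to the infimum is the
    minimum.\<close>
  obtain g where g: "g \<in> G" "g < Inf G + W"
    using cInf_lessD[OF G0, of "Inf G + W"] W by auto
  have G_min: "g \<le> h" if h: "h \<in> G" for h
  proof (rule ccontr)
    assume "\<not> g \<le> h"
    moreover have "Inf G \<le> h" using cInf_lower[OF h bdd] .
    moreover obtain k l where "k \<in> int_lattice" "l \<in> int_lattice" "g = k \<bullet> n" "h = l \<bullet> n"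
      using g h by (auto simp: G_def)
    ultimately show False using gap[of "k - l"] g(2) by (auto simp: int_lattice_diff inner_diff_left)
  qed
  have g_pos: "g > 0" using G_ge[OF g(1)] W by linarith
  obtain k0 where k0: "k0 \<in> int_lattice" "g = k0 \<bullet> n" using g by (auto simp: G_def)
  define a where "a = (\<chi> i. real_of_int \<lfloor>n $ i / g\<rfloor>)"
  have na: "n $ i = g * a $ i" for i
  proof (rule ccontr)
    assume ne: "n $ i \<noteq> g * a $ i"
    define k where "k = axis i 1 - (a $ i) *\<^sub>R k0"
    have k: "k \<in> int_lattice" unfolding k_def
      by (intro int_lattice_diff e int_lattice_scale k0) (simp add: a_def)
    have kn: "k \<bullet> n = n $ i - g * a $ i" by (simp add: k_def inner_diff_left en k0(2))
    have "a $ i * g \<le> n $ i" "n $ i < (a $ i + 1) * g"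
      using g_pos by (simp_all add: a_def floor_divide_lower floor_divide_upper)
    with ne kn have "0 < k \<bullet> n" "k \<bullet> n < g" by (auto simp: algebra_simps)
    with k G_min[of "k \<bullet> n"] show False by (auto simp: G_def)
  qed
  then have n_eq: "n = g *\<^sub>R a" by (simp add: vec_eq_iff)
  have "g * norm a = 1" using n g_pos n_eq by (metis abs_of_pos norm_scaleR)
  show thesis
  proof (rule that[of "perp a"])
    show "perp a \<in> int_lattice" by (rule perp_in_int_lattice) (simp add: int_lattice_def a_def)
    show "perp a \<noteq> 0" using \<open>g * norm a = 1\<close> norm_perp[of a]
      by (metis mult_zero_right norm_zero zero_neq_one)
    show "perp a \<bullet> n = 0" unfolding n_eq by (simp add: inner_2 perp_def)
    have "norm a * W \<le> norm a * g" using G_ge[OF g(1)] by (intro mult_left_mono) auto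
    then show "norm (perp a) * W \<le> 1" using \<open>g * norm a = 1\<close> by (simp add: mult.commute)
  qed
qed

section \<open>The side of a curve near a point of contact\<close>

text \<open>The set is the union of the segments \<open>{f y<..<a} \<times> {y}\<close>, all of which cross the segment of points with first
coordinate \<open>c\<close>.\<close>

lemma connected_strip_above_graph:
  fixes f :: "real \<Rightarrow> real"
  assumes "\<And>y. \<bar>y\<bar> < b \<Longrightarrow> f y < c" "c < a" "0 < b"
  shows "connected {(x, y). x < a \<and> \<bar>y\<bar> < b \<and> f y < x}"
proof -
  let ?S = "\<lambda>y. {f y<..<a} \<times> {y} \<union> {c} \<times> {-b<..<b}"
  have "connected (\<Union>y\<in>{-b<..<b}. ?S y)"
  proof (rule connected_Union)
    fix S assume "S \<in> ?S ` {-b<..<b}"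
    then obtain y where y: "y \<in> {-b<..<b}" "S = ?S y" by (rule imageE)
    then have "\<bar>y\<bar> < b" by auto
    then show "connected S"
      unfolding y(2)
    proof (intro connected_Un connected_Times)
      have "(c, y) \<in> {f y<..<a} \<times> {y} \<inter> {c} \<times> {-b<..<b}"
        using y(1) assms(1)[of y] assms(2) \<open>\<bar>y\<bar> < b\<close> by auto
      then show "{f y<..<a} \<times> {y} \<inter> {c} \<times> {-b<..<b} \<noteq> {}" by blast
    qed simp_all
  next
    have "(c, 0) \<in> \<Inter> (?S ` {-b<..<b})" using assms(3) by auto
    then show "\<Inter> (?S ` {-b<..<b}) \<noteq> {}" by blast
  qed
  moreover have "(\<Union>y\<in>{-b<..<b}. ?S y) = {(x, y). x < a \<and> \<bar>y\<bar> < b \<and> f y < x}"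
    using assms by auto
  ultimately show ?thesis by simp
qed

text \<open>The box minus the graph has the two connected pieces \<open>P\<close> (above) and \<open>N\<close> (below), and neither meets the frontier.
So each of them lies in \<open>E\<close> or misses it. The lower piece contains points with negative first
coordinate, so it misses \<open>E\<close>; as \<open>E\<close> accumulates at the origin, the upper piece lies in \<open>E\<close>.\<close>

lemma open_set_above_frontier_graph:
  fixes E :: "(real \<times> real) set"
  assumes "open E" "0 < a" "0 < b" "(0, 0) \<in> closure E"
    and pos: "\<And>x y. (x, y) \<in> E \<Longrightarrow> 0 < x"
    and graph: "\<And>x y. \<bar>x\<bar> < a \<Longrightarrow> \<bar>y\<bar> < b \<Longrightarrow> (x, y) \<in> frontier E \<longleftrightarrow> x = f y"
    and f: "\<And>y. \<bar>y\<bar> < b \<Longrightarrow> 0 \<le> f y \<and> f y < c" and "c < a"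
    and xy: "\<bar>x\<bar> < a" "\<bar>y\<bar> < b"
  shows "(x, y) \<in> E \<longleftrightarrow> f y < x"
proof -
  have disj: "E \<inter> frontier E = {}" using assms(1) by (simp add: frontier_def interior_open)
  define P where "P = {(x, y). x < a \<and> \<bar>y\<bar> < b \<and> f y < x}"
  define M where "M = {(x, y). x < a \<and> \<bar>y\<bar> < b \<and> - f y < x}"
  define N where "N = (\<lambda>(x, y). (- x, y)) ` M"
  have P: "connected P" unfolding P_def
    by (rule connected_strip_above_graph[where c = c]) (use f assms in auto)
  have M: "connected M" unfolding M_def
    by (rule connected_strip_above_graph[where f = "\<lambda>y. - f y" and c = "a / 2"]) (use f assms in force)+
  have N: "connected N" unfolding N_def
    by (rule connected_continuous_image[OF _ M]) (auto intro!: continuous_intros simp: case_prod_unfold)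
  have N_iff: "(x, y) \<in> N \<longleftrightarrow> - a < x \<and> \<bar>y\<bar> < b \<and> x < f y" for x y
    unfolding N_def M_def by (auto simp: image_iff intro!: exI[of _ "- x"])
  have "N \<inter> frontier E = {}"
  proof (rule equals0I)
    fix q assume q: "q \<in> N \<inter> frontier E"
    obtain x y where [simp]: "q = (x, y)" by force
    from q have "- a < x" "\<bar>y\<bar> < b" "x < f y" "(x, y) \<in> frontier E" by (auto simp: N_iff)
    moreover from this have "\<bar>x\<bar> < a" using f[of y] \<open>c < a\<close> by linarith
    ultimately show False using graph[of x y] by auto
  qed
  moreover have "N - E \<noteq> {}"
  proof -
    have "0 \<le> f 0" using f[of 0] \<open>0 < b\<close> by simp
    then have "- (a / 2) < f 0" using \<open>0 < a\<close> by linarith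
    then have "(- a / 2, 0) \<in> N" using \<open>0 < a\<close> \<open>0 < b\<close> by (simp add: N_iff)
    moreover have "(- a / 2, 0) \<notin> E" using pos[of "- a / 2" 0] assms(2) by auto
    ultimately show ?thesis by blast
  qed
  ultimately have NE: "N \<inter> E = {}" using connected_Int_frontier[OF N] by blast
  have "P \<inter> frontier E = {}"
  proof (rule equals0I)
    fix q assume q: "q \<in> P \<inter> frontier E"
    obtain x y where [simp]: "q = (x, y)" by force
    from q have "x < a" "\<bar>y\<bar> < b" "f y < x" "(x, y) \<in> frontier E" by (auto simp: P_def)
    moreover from this have "\<bar>x\<bar> < a" using f[of y] by linarith
    ultimately show False using graph[of x y] by auto
  qed
  moreover have "P \<inter> E \<noteq> {}"
  proof -
    have "open ({-a<..<a} \<times> {-b<..<b})" by (intro open_Times) auto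
    moreover have "(0, 0) \<in> {-a<..<a} \<times> {-b<..<b}" using assms by auto
    ultimately have "({-a<..<a} \<times> {-b<..<b}) \<inter> E \<noteq> {}"
      using assms(4) open_Int_closure_eq_empty by blast
    then obtain x y where "(x, y) \<in> E" "x \<in> {-a<..<a}" "y \<in> {-b<..<b}" by blast
    then have q: "\<bar>x\<bar> < a" "\<bar>y\<bar> < b" "(x, y) \<in> E" by auto
    then have "x \<noteq> f y" using graph[OF q(1,2)] disj by blast
    moreover have "\<not> x < f y" using q NE N_iff[of x y] by auto
    ultimately have "(x, y) \<in> P" using q by (auto simp: P_def)
    with q show ?thesis by blast
  qed
  ultimately have PE: "P \<subseteq> E" using connected_Int_frontier[OF P] by blast
  show ?thesis
  proof
    assume E: "(x, y) \<in> E"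
    then have "x \<noteq> f y" using graph[OF xy] disj by blast
    moreover have "\<not> x < f y" using E xy NE N_iff[of x y] by auto
    ultimately show "f y < x" by simp
  next
    assume "f y < x"
    then have "(x, y) \<in> P" using xy by (auto simp: P_def)
    with PE show "(x, y) \<in> E" by blast
  qed
qed

lemma second_derivative_strict_local_min:
  fixes h :: "real \<Rightarrow> real"
  assumes h: "\<And>t. (h has_real_derivative h' t) (at t)" and h': "(h' has_real_derivative c) (at s)"
    and "h s = 0" "h' s = 0" "0 < c"
  obtains d where "0 < d" "\<And>t. t \<noteq> s \<Longrightarrow> \<bar>t - s\<bar> < d \<Longrightarrow> 0 < h t"
proof -
  obtain d1 where d1: "d1 > 0" "\<And>e. 0 < e \<Longrightarrow> e < d1 \<Longrightarrow> h' s < h' (s + e)"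
    using DERIV_pos_inc_right[OF h' \<open>0 < c\<close>] by blast
  obtain d2 where d2: "d2 > 0" "\<And>e. 0 < e \<Longrightarrow> e < d2 \<Longrightarrow> h' (s - e) < h' s"
    using DERIV_pos_inc_left[OF h' \<open>0 < c\<close>] by blast
  show thesis
  proof (rule that[of "min d1 d2"])
    fix t assume t: "t \<noteq> s" "\<bar>t - s\<bar> < min d1 d2"
    show "0 < h t"
    proof (cases "s < t")
      case True
      then obtain u where u: "s < u" "u < t" "h t - h s = (t - s) * h' u"
        using MVT2[OF True, of h h'] h by blast
      have "0 < h' u" using d1(2)[of "u - s"] u t \<open>h' s = 0\<close> by auto
      with u \<open>h s = 0\<close> True show ?thesis by simp
    next
      case False
      with t have ts: "t < s" by simp
      then obtain u where u: "t < u" "u < s" "h s - h t = (s - t) * h' u"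
        using MVT2[OF ts, of h h'] h by blast
      have "h' u < 0" using d2(2)[of "s - u"] u t \<open>h' s = 0\<close> by auto
      with u \<open>h s = 0\<close> ts have "(s - t) * h' u < 0" by (simp add: mult_pos_neg)
      with u \<open>h s = 0\<close> show ?thesis by simp
    qed
  qed (use d1 d2 in simp)
qed

text \<open>The normalisation \<open>x'' = y'\<^sup>2 / 2\<close> means that \<open>x\<close> behaves like \<open>y\<^sup>2 / 4\<close>. The factors \<open>1 / 8\<close>
and \<open>1 / 2\<close> leave room on both sides, so that \<open>x - y\<^sup>2 / 8\<close> and \<open>y\<^sup>2 / 2 - x\<close> both have a
strict local minimum at \<open>s\<close>.\<close>

lemma quadratic_contact:
  fixes x y :: "real \<Rightarrow> real"
  assumes x: "\<And>t. (x has_real_derivative x' t) (at t)" and x': "(x' has_real_derivative x'') (at s)"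
    and y: "\<And>t. (y has_real_derivative y' t) (at t)" and y': "(y' has_real_derivative y'') (at s)"
    and "x s = 0" "y s = 0" "x' s = 0" "0 < y' s" "x'' = (y' s)\<^sup>2 / 2"
  obtains d where "0 < d" "strict_mono_on {s - d..s + d} y"
    "\<And>t. t \<noteq> s \<Longrightarrow> \<bar>t - s\<bar> \<le> d \<Longrightarrow> (y t)\<^sup>2 / 8 < x t \<and> x t < (y t)\<^sup>2 / 2"
proof -
  have p: "(y' s)\<^sup>2 > 0" using assms by simp
  obtain d1 where d1: "0 < d1" "\<And>t. t \<noteq> s \<Longrightarrow> \<bar>t - s\<bar> < d1 \<Longrightarrow> 0 < x t - (y t)\<^sup>2 / 8"
  proof (rule second_derivative_strict_local_min)
    show "((\<lambda>t. x t - (y t)\<^sup>2 / 8) has_real_derivative x' t - y t * y' t / 4) (at t)" for t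
      by (auto intro!: derivative_eq_intros x y)
    show "((\<lambda>t. x' t - y t * y' t / 4) has_real_derivative (y' s)\<^sup>2 / 4) (at s)"
      by (auto intro!: derivative_eq_intros x' y y' simp: assms power2_eq_square)
  qed (use assms p in auto)
  obtain d2 where d2: "0 < d2" "\<And>t. t \<noteq> s \<Longrightarrow> \<bar>t - s\<bar> < d2 \<Longrightarrow> 0 < (y t)\<^sup>2 / 2 - x t"
  proof (rule second_derivative_strict_local_min)
    show "((\<lambda>t. (y t)\<^sup>2 / 2 - x t) has_real_derivative y t * y' t - x' t) (at t)" for t
      by (auto intro!: derivative_eq_intros x y)
    show "((\<lambda>t. y t * y' t - x' t) has_real_derivative (y' s)\<^sup>2 / 2) (at s)"
      by (auto intro!: derivative_eq_intros x' y y' simp: assms power2_eq_square)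
  qed (use assms p in auto)
  have "isCont y' s" using y' by (rule DERIV_isCont)
  then have "eventually (\<lambda>t. 0 < y' t) (nhds s)"
    using \<open>0 < y' s\<close> order_tendstoD(1) unfolding isCont_def tendsto_at_iff_tendsto_nhds by blast
  then obtain d3 where d3: "d3 > 0" "\<And>t. \<bar>t - s\<bar> < d3 \<Longrightarrow> 0 < y' t"
    unfolding eventually_nhds_metric by (auto simp: dist_real_def)
  define d where "d = min d1 (min d2 d3) / 2"
  show thesis
  proof (rule that[of d])
    show "0 < d" using d1 d2 d3 by (simp add: d_def)
    show "strict_mono_on {s - d..s + d} y"
    proof (rule strict_mono_onI)
      fix a b assume ab: "a \<in> {s - d..s + d}" "b \<in> {s - d..s + d}" "a < b"
      then obtain u where u: "a < u" "u < b" "y b - y a = (b - a) * y' u"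
        using MVT2[OF ab(3), of y y'] y by blast
      have "\<bar>u - s\<bar> \<le> d" using u ab by auto
      then have "0 < y' u" using d3 d1(1) d2(1) by (intro d3(2)) (auto simp: d_def)
      with u ab show "y a < y b" using mult_pos_pos[of "b - a" "y' u"] by linarith
    qed
    fix t assume "t \<noteq> s" "\<bar>t - s\<bar> \<le> d"
    then show "(y t)\<^sup>2 / 8 < x t \<and> x t < (y t)\<^sup>2 / 2"
      using d1(2)[of t] d2(2)[of t] d1(1) d2(1) d3(1) by (auto simp: d_def)
  qed
qed

text \<open>Here the curve is given by a parametrisation. Since \<open>y\<close> is strictly increasing near \<open>s\<close>, the curve is the
graph of \<open>x \<circ> y\<^sup>-\<^sup>1\<close> there, and \<open>r\<close> ensures that no other arc of the curve enters the box.\<close>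

lemma open_set_near_quadratic_contact:
  fixes E :: "(real \<times> real) set" and x y :: "real \<Rightarrow> real"
  assumes E: "open E" "(0, 0) \<in> closure E" and pos: "\<And>x y. (x, y) \<in> E \<Longrightarrow> 0 < x"
    and d: "0 < d" and mono: "strict_mono_on {s - d..s + d} y" and cont: "continuous_on UNIV y"
    and s: "x s = 0" "y s = 0"
    and bounds: "\<And>t. t \<noteq> s \<Longrightarrow> \<bar>t - s\<bar> \<le> d \<Longrightarrow> (y t)\<^sup>2 / 8 < x t \<and> x t < (y t)\<^sup>2 / 2"
    and curve: "\<And>t. (x t, y t) \<in> frontier E"
    and r: "0 < r" "\<And>u v. (u, v) \<in> frontier E \<Longrightarrow> \<bar>u\<bar> < r \<Longrightarrow> \<bar>v\<bar> < r \<Longrightarrow> \<exists>t. \<bar>t - s\<bar> \<le> d \<and> u = x t \<and> v = y t"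
  obtains a where "0 < a"
    "\<And>u v. \<bar>u\<bar> < a \<Longrightarrow> \<bar>v\<bar> < a \<Longrightarrow> v\<^sup>2 / 2 \<le> u \<Longrightarrow> (u, v) \<noteq> (0, 0) \<Longrightarrow> (u, v) \<in> E"
    "\<And>u v. \<bar>u\<bar> < a \<Longrightarrow> \<bar>v\<bar> < a \<Longrightarrow> (u, v) \<in> E \<Longrightarrow> v\<^sup>2 \<le> 8 * u"
proof -
  have y0: "y (s - d) < 0" "0 < y (s + d)"
    using strict_mono_onD[OF mono, of "s - d" s] strict_mono_onD[OF mono, of s "s + d"] d s by auto
  \<comment> \<open>The bound \<open>a \<le> 1\<close> gives \<open>f v \<le> v\<^sup>2 / 2 \<le> a / 2\<close>, so the graph stays away from the top of the box.\<close>
  define a where "a = Min {r, y (s + d), - y (s - d), 1}"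
  have a: "0 < a" "a \<le> r" "a \<le> y (s + d)" "a \<le> - y (s - d)" "a \<le> 1"
    using r y0 by (auto simp: a_def)
  have ex: "\<exists>t. \<bar>t - s\<bar> \<le> d \<and> y t = v" if "\<bar>v\<bar> < a" for v
    using IVT'[of y "s - d" v "s + d"] that a d continuous_on_subset[OF cont]
    by (force simp: abs_le_iff)
  define \<tau> where "\<tau> = (\<lambda>v. SOME t. \<bar>t - s\<bar> \<le> d \<and> y t = v)"
  have \<tau>: "\<bar>\<tau> v - s\<bar> \<le> d" "y (\<tau> v) = v" if "\<bar>v\<bar> < a" for v
    using someI_ex[OF ex[OF that]] by (simp_all add: \<tau>_def)
  have uniq: "t = \<tau> v" if "\<bar>v\<bar> < a" "\<bar>t - s\<bar> \<le> d" "y t = v" for t v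
  proof (rule inj_onD[OF strict_mono_on_imp_inj_on[OF mono]])
    show "t \<in> {s - d..s + d}" "\<tau> v \<in> {s - d..s + d}" using that(2) \<tau>(1)[OF that(1)] by auto
    show "y t = y (\<tau> v)" using that(3) \<tau>(2)[OF that(1)] by simp
  qed
  define f where "f = x \<circ> \<tau>"
  have fb: "f v = 0 \<and> v = 0 \<or> v\<^sup>2 / 8 < f v \<and> f v < v\<^sup>2 / 2" if "\<bar>v\<bar> < a" for v
    using bounds[of "\<tau> v"] \<tau>[OF that] s by (cases "\<tau> v = s") (auto simp: f_def)
  have sq: "v\<^sup>2 \<le> a\<^sup>2" if "\<bar>v\<bar> < a" for v
    using that by (simp add: abs_le_square_iff[symmetric])
  have a2: "a\<^sup>2 \<le> a" using a by (simp add: power2_eq_square mult_left_le)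
  have iff: "(u, v) \<in> E \<longleftrightarrow> f v < u" if "\<bar>u\<bar> < a" "\<bar>v\<bar> < a" for u v
  proof (rule open_set_above_frontier_graph[OF E(1) a(1) a(1) E(2) pos _ _ _ that])
    fix u v assume uv: "\<bar>u\<bar> < a" "\<bar>v\<bar> < a"
    show "(u, v) \<in> frontier E \<longleftrightarrow> u = f v"
    proof
      assume "(u, v) \<in> frontier E"
      moreover have "\<bar>u\<bar> < r" "\<bar>v\<bar> < r" using uv a by auto
      ultimately obtain t where t: "\<bar>t - s\<bar> \<le> d" "u = x t" "v = y t" using r(2) by blast
      have "t = \<tau> v" by (rule uniq[OF uv(2) t(1) t(3)[symmetric]])
      with t(2) show "u = f v" by (simp only: f_def o_def)
    next
      assume "u = f v"
      then show "(u, v) \<in> frontier E" using curve[of "\<tau> v"] \<tau>[OF uv(2)] by (simp add: f_def)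
    qed
  next
    fix v assume v: "\<bar>v\<bar> < a"
    have "0 \<le> f v" using fb[OF v] zero_le_power2[of v] by linarith
    moreover have "f v \<le> a / 2" using fb[OF v] sq[OF v] a2 a(1) by linarith
    ultimately show "0 \<le> f v \<and> f v < 2 * a / 3" using a(1) by linarith
  qed (use a in auto)
  show thesis
  proof (rule that[OF a(1)])
    fix u v assume uv: "\<bar>u\<bar> < a" "\<bar>v\<bar> < a"
    { assume "v\<^sup>2 / 2 \<le> u" "(u, v) \<noteq> (0, 0)"
      then have "f v < u" using fb[OF uv(2)] by auto
      then show "(u, v) \<in> E" using iff[OF uv] by simp }
    { assume "(u, v) \<in> E"
      then have "f v < u" using iff[OF uv] by simp
      then show "v\<^sup>2 \<le> 8 * u" using fb[OF uv(2)] by auto }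
  qed
qed

section \<open>Glancing points of a regular curve\<close>

text \<open>This is the determinant of velocity and acceleration, the numerator of the signed curvature.\<close>

definition curve_det :: "(circle \<Rightarrow> real^2) \<Rightarrow> circle \<Rightarrow> real" where
  "curve_det \<gamma> \<theta> = perp (circle_deriv \<gamma> \<theta>) \<bullet> circle_deriv (circle_deriv \<gamma>) \<theta>"

lemma curvature_pos:
  assumes "circle_deriv \<gamma> \<theta> \<noteq> 0" "curve_det \<gamma> \<theta> \<noteq> 0"
  shows "curvature \<gamma> \<theta> > 0"
proof -
  let ?v = "circle_deriv \<gamma> \<theta>" and ?a = "circle_deriv (circle_deriv \<gamma>) \<theta>"
  have "(norm ?a)\<^sup>2 * (norm ?v)\<^sup>2 - (?a \<bullet> ?v)\<^sup>2 = (curve_det \<gamma> \<theta>)\<^sup>2"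
    unfolding power2_norm_eq_inner curve_det_def by (simp add: inner_2 perp_def power2_eq_square algebra_simps)
  with assms show ?thesis by (simp add: curvature_def Let_def)
qed

lemma C2_curve_has_derivatives:
  assumes "C2_curve \<gamma>"
  shows "((\<lambda>t. \<gamma> (of_angle t)) has_vector_derivative circle_deriv \<gamma> (of_angle t)) (at t)"
    and "((\<lambda>t. circle_deriv \<gamma> (of_angle t)) has_vector_derivative
           circle_deriv (circle_deriv \<gamma>) (of_angle t)) (at t)"
  using assms unfolding C2_curve_def circle_differentiable_def circle_deriv_of_angle
  by (auto simp: vector_derivative_works[symmetric])

lemma regular_curve_region:
  assumes "\<gamma> \<in> regular_curves"
  shows "C2_curve \<gamma>" "continuous_on UNIV \<gamma>" "inj \<gamma>" "enclosed \<gamma> \<noteq> {}" "open (enclosed \<gamma>)"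
    "connected (enclosed \<gamma>)" "bounded (enclosed \<gamma>)" "frontier (enclosed \<gamma>) = range \<gamma>"
    "inj_on torus_proj (closure (enclosed \<gamma>))" "circle_deriv \<gamma> \<theta> \<noteq> 0" "\<gamma> \<theta> \<in> closure (enclosed \<gamma>)"
proof -
  show 1: "C2_curve \<gamma>" "inj \<gamma>" "inj_on torus_proj (closure (enclosed \<gamma>))" "circle_deriv \<gamma> \<theta> \<noteq> 0"
    using assms by (auto simp: regular_curves_def properly_projected_def)
  show 2: "continuous_on UNIV \<gamma>"
    using 1 circle_differentiable_imp_continuous by (auto simp: C2_curve_def)
  show "enclosed \<gamma> \<noteq> {}" "open (enclosed \<gamma>)" "connected (enclosed \<gamma>)" "bounded (enclosed \<gamma>)"
    and 3: "frontier (enclosed \<gamma>) = range \<gamma>"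
    using Jordan_enclosed[OF 2 1(2)] by auto
  show "\<gamma> \<theta> \<in> closure (enclosed \<gamma>)" using 3 by (auto simp: frontier_def)
qed

lemma frontier_torus_region:
  assumes "\<gamma> \<in> regular_curves"
  shows "frontier (torus_proj ` enclosed \<gamma>) = torus_proj ` range \<gamma>"
  using frontier_torus_proj_image regular_curve_region[OF assms] by metis

text \<open>The function \<open>(\<gamma> - \<gamma> \<sigma>) \<bullet> n\<close> has a minimum at \<open>\<sigma>\<close>.\<close>

lemma supported_curve_derivatives:
  assumes \<gamma>: "C2_curve \<gamma>" and pos: "\<And>\<theta>. (\<gamma> \<theta> - \<gamma> \<sigma>) \<bullet> n \<ge> 0"
  shows "circle_deriv \<gamma> \<sigma> \<bullet> n = 0" "circle_deriv (circle_deriv \<gamma>) \<sigma> \<bullet> n \<ge> 0"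
proof -
  define s where "s = rep_angle \<sigma>"
  have s: "of_angle s = \<sigma>" by (simp add: s_def)
  let ?h = "\<lambda>t. (\<gamma> (of_angle t) - \<gamma> \<sigma>) \<bullet> n"
  let ?h' = "\<lambda>t. circle_deriv \<gamma> (of_angle t) \<bullet> n"
  let ?h'' = "\<lambda>t. circle_deriv (circle_deriv \<gamma>) (of_angle t) \<bullet> n"
  have h: "(?h has_real_derivative ?h' t) (at t)" for t
    unfolding has_real_derivative_iff_has_vector_derivative
    by (auto intro!: derivative_eq_intros C2_curve_has_derivatives[OF \<gamma>] bounded_linear.has_vector_derivative[OF bounded_linear_inner_left])
  have h': "(?h' has_real_derivative ?h'' t) (at t)" for t
    unfolding has_real_derivative_iff_has_vector_derivative
    by (intro bounded_linear.has_vector_derivative[OF bounded_linear_inner_left] C2_curve_has_derivatives[OF \<gamma>])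
  have "?h' s = 0"
    by (rule DERIV_local_min[OF h, of 1]) (use pos in \<open>auto simp: s\<close>)
  then show 1: "circle_deriv \<gamma> \<sigma> \<bullet> n = 0" by (simp add: s)
  show "circle_deriv (circle_deriv \<gamma>) \<sigma> \<bullet> n \<ge> 0"
  proof (rule ccontr)
    assume "\<not> ?thesis"
    then have neg: "0 < - ?h'' s" by (simp add: s)
    obtain d where d: "0 < d" "\<And>t. t \<noteq> s \<Longrightarrow> \<bar>t - s\<bar> < d \<Longrightarrow> 0 < - ?h t"
    proof (rule second_derivative_strict_local_min[OF _ _ _ _ neg])
      show "((\<lambda>t. - ?h t) has_real_derivative - ?h' t) (at t)" for t by (rule DERIV_minus[OF h])
      show "((\<lambda>t. - ?h' t) has_real_derivative - ?h'' s) (at s)" by (rule DERIV_minus[OF h'])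
    qed (use 1 s in auto)
    from d(2)[of "s + d / 2"] d(1) pos[of "of_angle (s + d / 2)"] show False by simp
  qed
qed

text \<open>The nontrivial translates of the compact closure form a closed set, which does not contain \<open>p\<close>.\<close>

lemma covering_isolates_region:
  assumes "bounded S" "inj_on torus_proj (closure S)" "p \<in> closure S"
  obtains r where "0 < r" "\<And>q. dist p q < r \<Longrightarrow> torus_proj q \<in> torus_proj ` S \<Longrightarrow> q \<in> S"
proof -
  define T where "T = (\<Union>k\<in>int_lattice - {0}. \<Union>y\<in>closure S. {k + y})"
  have "closed T" unfolding T_def
    by (rule closed_compact_sums[OF closed_int_lattice]) (use assms(1) in \<open>auto simp: compact_closure\<close>)
  moreover have "p \<notin> T"
  proof
    assume "p \<in> T"
    then obtain k y where k: "k \<in> int_lattice" "k \<noteq> 0" "y \<in> closure S" "p = k + y" by (auto simp: T_def)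
    then have "torus_proj y = torus_proj p" by (simp add: torus_proj_eq_iff)
    with assms(2,3) k have "y = p" by (auto dest: inj_onD)
    have "k = p - y" by (simp add: k(4))
    then show False using \<open>y = p\<close> k(2) by (simp only: diff_self)
  qed
  ultimately obtain r where r: "0 < r" "ball p r \<subseteq> - T"
    using open_contains_ball[of "- T"] by (auto simp: open_Compl)
  show thesis
  proof (rule that[OF r(1)])
    fix q assume q: "dist p q < r" "torus_proj q \<in> torus_proj ` S"
    then obtain y where y: "y \<in> S" "q - y \<in> int_lattice" by (metis imageE torus_proj_eq_iff)
    have "q - y = 0"
    proof (rule ccontr)
      assume "q - y \<noteq> 0"
      then have "q \<in> T" unfolding T_def using y closure_subset[of S]
        by (intro UN_I[of "q - y"] UN_I[of y]) auto
      with r q show False by auto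
    qed
    with y show "q \<in> S" by simp
  qed
qed

lemma ex_angle_near: "\<exists>t. of_angle t = \<theta> \<and> \<bar>t - s\<bar> \<le> pi"
proof -
  define a where "a = rep_angle \<theta>"
  define m where "m = round ((a - s) / (2 * pi))"
  define t where "t = a - 2 * pi * of_int m"
  have "of_angle t = \<theta>"
    using of_angle_eq_iff[of t a] by (auto simp: t_def a_def)
  moreover have "\<bar>of_int m - (a - s) / (2 * pi)\<bar> * (2 * pi) \<le> 1 / 2 * (2 * pi)"
    unfolding m_def by (intro mult_right_mono of_int_round_abs_le) auto
  moreover have "\<bar>of_int m - (a - s) / (2 * pi)\<bar> * (2 * pi) = \<bar>t - s\<bar>"
  proof -
    have "(of_int m - (a - s) / (2 * pi)) * (2 * pi) = - (t - s)"
      by (simp add: t_def field_simps)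
    then have "\<bar>(of_int m - (a - s) / (2 * pi)) * (2 * pi)\<bar> = \<bar>t - s\<bar>" by simp
    then show ?thesis by (simp add: abs_mult)
  qed
  ultimately show ?thesis by auto
qed

text \<open>By compactness and injectivity, points of the curve close to a given point have parameters close to
that of the given point.\<close>

lemma closed_curve_returns_only_at_parameter:
  assumes \<gamma>: "continuous_on UNIV \<gamma>" "inj (\<gamma> :: circle \<Rightarrow> real^2)" and "0 < d"
  obtains e where "0 < e"
    "\<And>\<theta>. dist (\<gamma> \<theta>) (\<gamma> (of_angle s)) < e \<Longrightarrow> \<exists>t. of_angle t = \<theta> \<and> \<bar>t - s\<bar> \<le> d"
proof -
  let ?g = "\<lambda>t. \<gamma> (of_angle t)"
  define T where "T = {t. d \<le> \<bar>t - s\<bar> \<and> \<bar>t - s\<bar> \<le> pi}"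
  have "T = cball s pi - ball s d" by (auto simp: T_def dist_real_def)
  then have "compact T" by (simp add: compact_diff)
  have "continuous_on UNIV ?g"
    by (rule continuous_on_compose2[OF \<gamma>(1) continuous_of_angle]) auto
  then have "compact (?g ` T)"
    using \<open>compact T\<close> by (meson compact_continuous_image continuous_on_subset subset_UNIV)
  then have "open (- ?g ` T)" by (simp add: compact_imp_closed open_Compl)
  moreover have "?g s \<notin> ?g ` T"
  proof
    assume "?g s \<in> ?g ` T"
    then obtain t where t: "t \<in> T" "?g s = ?g t" by blast
    then have "of_angle s = of_angle t" using \<gamma>(2) by (simp add: inj_eq)
    moreover have "\<bar>t - s\<bar> < 2 * pi"
    proof -
      have "\<bar>t - s\<bar> \<le> pi" using t by (simp add: T_def)
      then show ?thesis using pi_gt_zero by linarith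
    qed
    ultimately have "s = t" by (rule of_angle_eq_imp_eq)
    with t \<open>0 < d\<close> show False by (simp add: T_def)
  qed
  ultimately obtain e where e: "0 < e" "ball (?g s) e \<subseteq> - ?g ` T"
    by (meson ComplI openE)
  show thesis
  proof (rule that[OF e(1)])
    fix \<theta> assume "dist (\<gamma> \<theta>) (\<gamma> (of_angle s)) < e"
    obtain t where t: "of_angle t = \<theta>" "\<bar>t - s\<bar> \<le> pi" using ex_angle_near by blast
    have "?g t \<in> ball (?g s) e" using \<open>dist (\<gamma> \<theta>) (\<gamma> (of_angle s)) < e\<close> by (simp add: t dist_commute)
    then have "t \<notin> T" using e(2) by blast
    with t show "\<exists>t. of_angle t = \<theta> \<and> \<bar>t - s\<bar> \<le> d" by (auto simp: T_def intro!: exI[of _ t])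
  qed
qed

lemma closure_vimage_homeomorphism:
  assumes "homeomorphism UNIV UNIV f g"
  shows "closure (f -` S) = f -` closure S"
proof
  have f: "continuous_on UNIV f" and g: "continuous_on UNIV g" and gf: "\<And>x. g (f x) = x" and fg: "\<And>x. f (g x) = x"
    using assms by (auto simp: homeomorphism_def)
  have im: "g ` T = f -` T" for T using gf fg by (auto simp: image_iff) metis
  show "closure (f -` S) \<subseteq> f -` closure S"
    using f by (intro closure_minimal vimage_mono closure_subset closed_vimage[OF closed_closure]) (simp add: continuous_on_eq_continuous_at)
  show "f -` closure S \<subseteq> closure (f -` S)"
    unfolding im[symmetric] by (intro image_closure_subset continuous_on_subset[OF g] closed_closure closure_subset) auto
qed

text \<open>The coordinates \<open>l ((q - p) \<bullet> n)\<close> and \<open>(q - p) \<bullet> w\<close> turn the curve into one with a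
quadratic contact at the origin. The factor \<open>l\<close> fixes the second derivative, and the sign in \<open>w\<close> makes the curve run in
the direction of increasing second coordinate.\<close>

lemma region_near_curved_support_point:
  assumes \<gamma>: "\<gamma> \<in> regular_curves"
    and v: "norm v = 1" "norm n = 1" "n \<bullet> v = 0"
    and half: "\<And>x. x \<in> enclosed \<gamma> \<Longrightarrow> (x - \<gamma> \<sigma>) \<bullet> n > 0"
    and curved: "curve_det \<gamma> \<sigma> \<noteq> 0"
  obtains l w a where "0 < l" "w = v \<or> w = - v" "0 < a"
    "\<And>q. \<bar>l * ((q - \<gamma> \<sigma>) \<bullet> n)\<bar> < a \<Longrightarrow> \<bar>(q - \<gamma> \<sigma>) \<bullet> w\<bar> < a \<Longrightarrow> q \<noteq> \<gamma> \<sigma> \<Longrightarrow>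
       ((q - \<gamma> \<sigma>) \<bullet> w)\<^sup>2 / 2 \<le> l * ((q - \<gamma> \<sigma>) \<bullet> n) \<Longrightarrow> q \<in> enclosed \<gamma>"
    "\<And>q. \<bar>l * ((q - \<gamma> \<sigma>) \<bullet> n)\<bar> < a \<Longrightarrow> \<bar>(q - \<gamma> \<sigma>) \<bullet> w\<bar> < a \<Longrightarrow> q \<in> enclosed \<gamma> \<Longrightarrow>
       ((q - \<gamma> \<sigma>) \<bullet> w)\<^sup>2 \<le> 8 * (l * ((q - \<gamma> \<sigma>) \<bullet> n))"
proof -
  note R = regular_curve_region[OF \<gamma>]
  define s where "s = rep_angle \<sigma>"
  have s: "of_angle s = \<sigma>" by (simp add: s_def)
  define p where "p = \<gamma> \<sigma>"
  let ?v = "circle_deriv \<gamma> \<sigma>" and ?a = "circle_deriv (circle_deriv \<gamma>) \<sigma>"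
  have pos: "(\<gamma> \<theta> - \<gamma> \<sigma>) \<bullet> n \<ge> 0" for \<theta>
  proof -
    have "closure (enclosed \<gamma>) \<subseteq> {x. n \<bullet> x \<ge> n \<bullet> p}"
      by (rule closure_minimal[OF _ closed_halfspace_ge])
         (use half in \<open>fastforce simp: p_def inner_diff_left inner_diff_right inner_commute\<close>)
    with R(11)[of \<theta>] show ?thesis by (auto simp: p_def inner_diff_left inner_diff_right inner_commute)
  qed
  have tangent: "?v \<bullet> n = 0" and a0: "0 \<le> ?a \<bullet> n" using supported_curve_derivatives[OF R(1) pos] by auto
  have v_eq: "?v = (?v \<bullet> v) *\<^sub>R v" using orthonormal_expansion[OF v, of ?v] tangent by simp
  have vv: "?v \<bullet> v \<noteq> 0" using v_eq R(10)[of \<sigma>] by auto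
  have "?a \<bullet> n \<noteq> 0"
  proof
    assume "?a \<bullet> n = 0"
    then have "?a \<bullet> perp v = 0" using unit_normal_eq_perp[OF v] by auto
    moreover have "perp ?v = (?v \<bullet> v) *\<^sub>R perp v"
      by (subst v_eq) (rule linear_cmul[OF linear_perp])
    ultimately show False using curved by (simp add: curve_det_def inner_commute)
  qed
  with a0 have a: "0 < ?a \<bullet> n" by simp
  define w where "w = (if ?v \<bullet> v > 0 then v else - v)"
  have w: "norm w = 1" "n \<bullet> w = 0" "w = v \<or> w = - v" "0 < ?v \<bullet> w" using v vv by (auto simp: w_def)
  \<comment> \<open>This is the normalisation of \<open>quadratic_contact\<close>.\<close>
  define l where "l = (?v \<bullet> w)\<^sup>2 / (2 * (?a \<bullet> n))"
  have l: "0 < l" using w a by (simp add: l_def)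
  define f where "f = (\<lambda>(x, y). p + (x / l) *\<^sub>R n + y *\<^sub>R w)"
  define g where "g = (\<lambda>q. (l * ((q - p) \<bullet> n), (q - p) \<bullet> w))"
  have nn: "n \<bullet> n = 1" "w \<bullet> w = 1" "w \<bullet> n = 0" using v w by (auto simp: norm_eq_1 inner_commute)
  have gf: "g (f z) = z" for z
    using nn w l by (cases z) (simp add: f_def g_def inner_add_left)
  have fg: "f (g q) = q" for q
    using orthonormal_expansion[OF w(1) v(2) w(2), of "q - p"] l
    by (simp add: f_def g_def) (metis add.commute add.left_commute diff_add_cancel)
  have homeo: "homeomorphism UNIV UNIV f g"
  proof (rule homeomorphismI)
    show "continuous_on UNIV f" "continuous_on UNIV g"
      unfolding f_def g_def case_prod_unfold using l by (auto intro!: continuous_intros)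
  qed (auto simp: gf fg)
  define E where "E = f -` enclosed \<gamma>"
  have E_open: "open E"
    unfolding E_def using homeo R(5) by (auto simp: homeomorphism_def intro!: open_vimage)
  have E_closure: "closure E = f -` closure (enclosed \<gamma>)"
    unfolding E_def by (rule closure_vimage_homeomorphism[OF homeo])
  then have "frontier E = f -` (closure (enclosed \<gamma>) - enclosed \<gamma>)"
    using E_open by (simp add: frontier_def interior_open) (simp add: E_def vimage_Diff)
  also have "closure (enclosed \<gamma>) - enclosed \<gamma> = range \<gamma>"
    using R(5,8) by (simp add: frontier_def interior_open)
  finally have E_frontier: "frontier E = f -` range \<gamma>" .
  let ?x = "\<lambda>t. l * ((\<gamma> (of_angle t) - p) \<bullet> n)" and ?y = "\<lambda>t. (\<gamma> (of_angle t) - p) \<bullet> w"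
  note D = C2_curve_has_derivatives[OF R(1)]
  note D' = bounded_linear.has_vector_derivative[OF bounded_linear_inner_left]
  have x: "(?x has_real_derivative l * (circle_deriv \<gamma> (of_angle t) \<bullet> n)) (at t)" for t
    by (intro DERIV_cmult, unfold has_real_derivative_iff_has_vector_derivative)
       (auto intro!: derivative_eq_intros D D')
  have y: "(?y has_real_derivative circle_deriv \<gamma> (of_angle t) \<bullet> w) (at t)" for t
    unfolding has_real_derivative_iff_has_vector_derivative by (auto intro!: derivative_eq_intros D D')
  have x': "((\<lambda>t. l * (circle_deriv \<gamma> (of_angle t) \<bullet> n)) has_real_derivative l * (?a \<bullet> n)) (at s)"
    unfolding s[symmetric]
    by (intro DERIV_cmult, unfold has_real_derivative_iff_has_vector_derivative) (intro D D')
  have y': "((\<lambda>t. circle_deriv \<gamma> (of_angle t) \<bullet> w) has_real_derivative ?a \<bullet> w) (at s)"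
    unfolding s[symmetric] has_real_derivative_iff_has_vector_derivative by (intro D D')
  obtain d where d: "0 < d" "strict_mono_on {s - d..s + d} ?y"
    "\<And>t. t \<noteq> s \<Longrightarrow> \<bar>t - s\<bar> \<le> d \<Longrightarrow> (?y t)\<^sup>2 / 8 < ?x t \<and> ?x t < (?y t)\<^sup>2 / 2"
    by (rule quadratic_contact[OF x x' y y']) (use a tangent w in \<open>auto simp: s p_def l_def\<close>)
  obtain e where e: "0 < e"
    "\<And>\<theta>. dist (\<gamma> \<theta>) (\<gamma> (of_angle s)) < e \<Longrightarrow> \<exists>t. of_angle t = \<theta> \<and> \<bar>t - s\<bar> \<le> d"
    using closed_curve_returns_only_at_parameter[OF R(2,3) d(1)] by blast
  define r where "r = min (e / 2) (l * e / 2)"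
  have r: "0 < r" using e l by (simp add: r_def)
  have near: "\<exists>t. \<bar>t - s\<bar> \<le> d \<and> u = ?x t \<and> b = ?y t"
    if h: "(u, b) \<in> frontier E" "\<bar>u\<bar> < r" "\<bar>b\<bar> < r" for u b
  proof -
    obtain \<theta> where \<theta>: "f (u, b) = \<gamma> \<theta>" using h by (auto simp: E_frontier)
    have "norm ((u / l) *\<^sub>R n + b *\<^sub>R w) \<le> \<bar>u\<bar> / l + \<bar>b\<bar>"
      using norm_triangle_ineq[of "(u / l) *\<^sub>R n" "b *\<^sub>R w"] v w l by simp
    also have "\<bar>u\<bar> / l < e / 2" using h l by (simp add: r_def field_simps)
    also have "\<bar>b\<bar> < e / 2" using h by (simp add: r_def)
    finally have "dist (\<gamma> \<theta>) (\<gamma> (of_angle s)) < e"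
      by (simp add: \<theta>[symmetric] s p_def f_def dist_norm add.assoc)
    then obtain t where t: "of_angle t = \<theta>" "\<bar>t - s\<bar> \<le> d" using e by blast
    have "g (\<gamma> \<theta>) = (u, b)" using gf[of "(u, b)"] \<theta> by simp
    with t show ?thesis by (intro exI[of _ t]) (auto simp: g_def)
  qed
  have E0: "(0, 0) \<in> closure E"
    using R(11)[of \<sigma>] E_closure by (simp add: f_def p_def)
  have E_pos: "0 < u" if "(u, b) \<in> E" for u b
  proof -
    have "(f (u, b) - p) \<bullet> n > 0" using half that by (simp add: E_def p_def)
    with l have "0 < l * ((f (u, b) - p) \<bullet> n)" by (rule mult_pos_pos)
    also have "\<dots> = fst (g (f (u, b)))" by (simp only: g_def fst_conv)
    finally show ?thesis by (simp add: gf)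
  qed
  have y_cont: "continuous_on UNIV ?y"
    using y by (intro continuous_at_imp_continuous_on ballI DERIV_isCont) blast
  have curve: "(?x t, ?y t) \<in> frontier E" for t
    using fg[of "\<gamma> (of_angle t)"] by (simp add: E_frontier g_def)
  have xs: "?x s = 0" "?y s = 0" by (simp_all add: s p_def)
  obtain c where c: "0 < c"
    "\<And>u b. \<bar>u\<bar> < c \<Longrightarrow> \<bar>b\<bar> < c \<Longrightarrow> b\<^sup>2 / 2 \<le> u \<Longrightarrow> (u, b) \<noteq> (0, 0) \<Longrightarrow> (u, b) \<in> E"
    "\<And>u b. \<bar>u\<bar> < c \<Longrightarrow> \<bar>b\<bar> < c \<Longrightarrow> (u, b) \<in> E \<Longrightarrow> b\<^sup>2 \<le> 8 * u"
    by (rule open_set_near_quadratic_contact[where x = ?x and y = ?y and s = s,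
          OF E_open E0 E_pos d(1,2) y_cont xs d(3) curve r near]) (assumption | rule that)+
  have E_iff: "g q \<in> E \<longleftrightarrow> q \<in> enclosed \<gamma>" for q by (simp add: E_def fg)
  show thesis
  proof (rule that[OF l w(3) c(1)])
    fix q assume q: "\<bar>l * ((q - \<gamma> \<sigma>) \<bullet> n)\<bar> < c" "\<bar>(q - \<gamma> \<sigma>) \<bullet> w\<bar> < c"
    have g_eq: "g q = (l * ((q - \<gamma> \<sigma>) \<bullet> n), (q - \<gamma> \<sigma>) \<bullet> w)"
      by (simp add: g_def p_def)
    { assume ne: "q \<noteq> \<gamma> \<sigma>" and le: "((q - \<gamma> \<sigma>) \<bullet> w)\<^sup>2 / 2 \<le> l * ((q - \<gamma> \<sigma>) \<bullet> n)"
      have "g q \<noteq> (0, 0)"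
      proof
        assume "g q = (0, 0)"
        then have "q = f (0, 0)" using fg[of q] by simp
        with ne show False by (simp add: f_def p_def)
      qed
      then have "g q \<in> E" unfolding g_eq by (rule c(2)[OF q le])
      then show "q \<in> enclosed \<gamma>" by (simp add: E_iff) }
    { assume "q \<in> enclosed \<gamma>"
      then have "g q \<in> E" by (simp add: E_iff)
      then show "((q - \<gamma> \<sigma>) \<bullet> w)\<^sup>2 \<le> 8 * (l * ((q - \<gamma> \<sigma>) \<bullet> n))"
        unfolding g_eq by (rule c(3)[OF q]) }
  qed
qed

lemma glancing_point_on_curve:
  assumes "\<gamma> \<in> regular_curves" "z \<in> frontier (torus_proj ` enclosed \<gamma>)"
  obtains \<sigma> where "z = torus_proj (\<gamma> \<sigma>)"
  using assms frontier_torus_region by blast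

lemma abs_powr_2: "\<bar>x\<bar> powr 2 = (x :: real)\<^sup>2"
  by (cases "x = 0") simp_all

text \<open>The chart is the affine map of \<open>region_near_curved_support_point\<close> on a ball around \<open>p\<close> so small that it meets
neither a nontrivial translate of the region nor another lift of \<open>L\<close>. The same smallness shows that the
point is one-sided, with \<open>- n\<close> pointing to the empty side.\<close>

lemma curved_glancing_point_has_order_2:
  assumes \<gamma>: "\<gamma> \<in> regular_curves" and gl: "glancing_line (torus_proj ` enclosed \<gamma>) L"
    and zL: "torus_proj (\<gamma> \<sigma>) \<in> L" and curved: "curve_det \<gamma> \<sigma> \<noteq> 0"
  shows "has_order (torus_proj ` enclosed \<gamma>) L (torus_proj (\<gamma> \<sigma>)) 2"
proof -
  note R = regular_curve_region[OF \<gamma>]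
  define p where "p = \<gamma> \<sigma>"
  define E where "E = enclosed \<gamma>"
  have z_frontier: "torus_proj p \<in> frontier (torus_proj ` E)"
    unfolding E_def p_def frontier_torus_region[OF \<gamma>] by blast
  have p_cl: "p \<in> closure E" using R(11) by (simp add: p_def E_def)
  have contact: "\<exists>\<psi> U C\<^sub>i\<^sub>n C\<^sub>o\<^sub>u\<^sub>t. affine_chart \<psi> U \<and> torus_proj p \<in> U \<and> \<psi> (torus_proj p) = 0 \<and>
        \<psi> ` (L \<inter> U) = {q \<in> \<psi> ` U. q $ 1 = 0} \<and> C\<^sub>o\<^sub>u\<^sub>t > C\<^sub>i\<^sub>n \<and> C\<^sub>i\<^sub>n > 1 \<and>
        contact_inner 2 C\<^sub>i\<^sub>n (\<psi> ` U) \<inter> {q. q $ 1 \<ge> 0 \<and> q $ 2 \<ge> 0} \<subseteq> \<psi> ` (torus_proj ` E \<inter> U) \<and>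
        \<psi> ` (torus_proj ` E \<inter> U) \<subseteq> contact_outer 2 C\<^sub>o\<^sub>u\<^sub>t (\<psi> ` U) \<inter> {q. q $ 1 \<ge> 0}"
    and one_side: "one_sided (torus_proj ` E) (torus_proj p) v"
    if dir: "line_direction L v" for v
  proof -
    have v: "norm v = 1" using dir by (simp add: line_direction_def)
    have L: "L = torus_line (torus_proj p) v"
      using torus_line_through[OF dir zL] by (simp add: p_def)
    have avoid: "torus_line (torus_proj p) v \<inter> torus_proj ` E = {}"
      using gl by (simp add: glancing_line_def L E_def)
    obtain n where n: "norm n = 1" "n \<bullet> v = 0" and half: "\<And>x. x \<in> E \<Longrightarrow> (x - p) \<bullet> n > 0"
      using avoiding_region_halfplane[OF avoid v R(6)[folded E_def]] by blast
    obtain l w a where l: "0 < l" and w: "w = v \<or> w = - v" and a: "0 < a"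
      and inner: "\<And>q. \<bar>l * ((q - p) \<bullet> n)\<bar> < a \<Longrightarrow> \<bar>(q - p) \<bullet> w\<bar> < a \<Longrightarrow> q \<noteq> p \<Longrightarrow>
          ((q - p) \<bullet> w)\<^sup>2 / 2 \<le> l * ((q - p) \<bullet> n) \<Longrightarrow> q \<in> E"
      and outer: "\<And>q. \<bar>l * ((q - p) \<bullet> n)\<bar> < a \<Longrightarrow> \<bar>(q - p) \<bullet> w\<bar> < a \<Longrightarrow> q \<in> E \<Longrightarrow>
          ((q - p) \<bullet> w)\<^sup>2 \<le> 8 * (l * ((q - p) \<bullet> n))"
      using region_near_curved_support_point[OF \<gamma> v n half[unfolded p_def E_def] curved]
      unfolding p_def E_def by blast
    have w1: "norm w = 1" "n \<bullet> w = 0" using v n w by auto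
    obtain q0 where q0: "q0 \<in> E" using R(4) by (auto simp: E_def)
    define W where "W = (q0 - p) \<bullet> n"
    have W: "0 < W" using half[OF q0] by (simp add: W_def)
    have gap: "\<not> (0 < k \<bullet> n \<and> k \<bullet> n < W)" if "k \<in> int_lattice" for k
      unfolding W_def
      by (rule avoiding_region_gap[OF avoid v R(6)[folded E_def] n p_cl _ that]) (use q0 closure_subset in blast)
    obtain r where r: "0 < r"
      and iso: "\<And>q. dist p q < r \<Longrightarrow> torus_proj q \<in> torus_proj ` E \<Longrightarrow> q \<in> E"
      using covering_isolates_region[OF R(7,9)[folded E_def] p_cl] by blast
    \<comment> \<open>The first two entries keep the ball inside the box of the local description, \<open>r\<close> keeps the translates
      of the region away, \<open>1 / 2\<close> makes the projection injective, and \<open>W / 2\<close> keeps the other lifts of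
      the line away, also after a shift by less than \<open>W / 2\<close>.\<close>
    define \<rho> where "\<rho> = Min {a / l, a, r, 1 / 2, W / 2}"
    have \<rho>: "0 < \<rho>" "\<rho> \<le> a / l" "\<rho> \<le> a" "\<rho> \<le> r" "\<rho> \<le> 1 / 2" "\<rho> \<le> W / 2"
    proof -
      show "0 < \<rho>" unfolding \<rho>_def using l a r W by (subst Min_gr_iff) auto
    qed (unfold \<rho>_def, (rule Min_le; simp)+)
    define V where "V = ball p \<rho>"
    have pV: "p \<in> V" using \<rho> by (simp add: V_def)
    have small_n: "\<bar>(q - p) \<bullet> n\<bar> < \<rho>" and small_w: "\<bar>(q - p) \<bullet> w\<bar> < \<rho>" if "q \<in> V" for q
      using that Cauchy_Schwarz_ineq2[of "q - p" n] Cauchy_Schwarz_ineq2[of "q - p" w] n w1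
      by (auto simp: V_def dist_norm norm_minus_commute)
    have small: "\<bar>l * ((q - p) \<bullet> n)\<bar> < a" "\<bar>(q - p) \<bullet> w\<bar> < a" if "q \<in> V" for q
    proof -
      have "l * \<bar>(q - p) \<bullet> n\<bar> < l * (a / l)"
        using small_n[OF that] \<rho>(2) l by (intro mult_strict_left_mono) auto
      then show "\<bar>l * ((q - p) \<bullet> n)\<bar> < a" using l by (simp add: abs_mult)
      show "\<bar>(q - p) \<bullet> w\<bar> < a" using small_w[OF that] \<rho>(3) by simp
    qed
    have isoV: "q \<in> E" if "q \<in> V" "torus_proj q \<in> torus_proj ` E" for q
      using iso that \<rho>(4) by (auto simp: V_def)
    have injV: "inj_on torus_proj V"
    proof (rule inj_onI)
      fix x y assume "x \<in> V" "y \<in> V" "torus_proj x = torus_proj y"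
      then have "dist p x < 1 / 2" "dist p y < 1 / 2" "y - x \<in> int_lattice"
        using \<rho>(5) by (auto simp: V_def torus_proj_eq_iff)
      moreover from this have "dist x y < 1 / 2 + 1 / 2" using dist_triangle_half_r[of p x 1 y] by simp
      then have "norm (y - x) < 1" by (simp add: dist_norm norm_minus_commute)
      ultimately show "x = y" using norm_int_lattice_ge_1[of "y - x"] by auto
    qed
    show "one_sided (torus_proj ` E) (torus_proj p) v"
      unfolding one_sided_def
    proof (intro exI conjI allI impI)
      show "open (torus_proj ` V)" by (rule open_torus_proj_image) (simp add: V_def)
      show "torus_proj p \<in> torus_proj ` V" using pV by blast
      show "norm (- n) = 1" "v \<bullet> (- n) = 0" using n by (simp_all add: inner_commute)
      show "0 < W / 2" using W by simp
      fix s assume s: "0 < s \<and> s < W / 2"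
      show "torus_line (torus_add (torus_proj p) (s *\<^sub>R - n)) v \<inter> torus_proj ` V \<inter> torus_proj ` E = {}"
      proof (rule equals0I)
        fix y assume y: "y \<in> torus_line (torus_add (torus_proj p) (s *\<^sub>R - n)) v \<inter> torus_proj ` V \<inter> torus_proj ` E"
        then obtain q where q: "q \<in> V" "y = torus_proj q" by blast
        then have "q \<in> E" using isoV y by blast
        obtain t k where k: "k \<in> int_lattice" "q = p + s *\<^sub>R - n + t *\<^sub>R v + k"
          using y q mem_torus_line_proj by (auto simp: torus_add_proj)
        have "(q - p) \<bullet> n = k \<bullet> n - s"
          using n by (simp add: k(2) inner_add_left inner_diff_left inner_commute[of v] norm_eq_1)
        moreover have "0 < (q - p) \<bullet> n" "(q - p) \<bullet> n < W / 2"
          using half[OF \<open>q \<in> E\<close>] small_n[OF q(1)] \<rho>(6) by auto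
        ultimately show False using gap[OF k(1)] s by linarith
      qed
    qed
    define F :: "real^2 \<Rightarrow> real^2" where "F = (\<lambda>q. vector [l * (q \<bullet> n), q \<bullet> w])"
    have F_lin: "linear F"
      by (rule linearI) (simp_all add: F_def vec_eq_iff forall_2 inner_add_left algebra_simps)
    have F0: "q = 0" if "F q = 0" for q
    proof -
      have "F q $ 1 = 0" "F q $ 2 = 0" using that by simp_all
      then have "q \<bullet> n = 0" "q \<bullet> w = 0" using l by (simp_all add: F_def)
      then show ?thesis using orthonormal_expansion[OF w1(1) n(1) w1(2), of q] by simp
    qed
    then have "inj F" using F_lin by (simp add: linear_injective_0)
    then have F_bij: "bij F" using F_lin by (simp add: bij_def linear_injective_imp_surjective)
    define A where "A = (\<lambda>q. F q + (- F p))"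
    have A_eq: "A q = F (q - p)" for q using F_lin by (simp add: A_def linear_diff)
    have A1: "A q $ 1 = l * ((q - p) \<bullet> n)" and A2: "A q $ 2 = (q - p) \<bullet> w" for q
      by (simp_all add: A_eq F_def)
    have A0: "A q = 0 \<longleftrightarrow> q = p" for q using F0[of "q - p"] F_lin by (auto simp: A_eq linear_0)
    define \<psi> where "\<psi> = (\<lambda>z. A (the_inv_into V torus_proj z))"
    have \<psi>: "\<psi> (torus_proj q) = A q" if "q \<in> V" for q
      using the_inv_into_f_f[OF injV that] by (simp add: \<psi>_def)
    define U where "U = torus_proj ` V"
    have \<psi>U: "\<psi> ` U = A ` V" unfolding U_def image_image using \<psi> by simp
    have \<psi>D: "\<psi> ` (torus_proj ` E \<inter> U) = A ` (V \<inter> E)"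
    proof -
      have "torus_proj ` E \<inter> U = torus_proj ` (V \<inter> E)" 
      proof (intro equalityI subsetI)
        fix y assume "y \<in> torus_proj ` E \<inter> U"
        then obtain q where "q \<in> V" "y = torus_proj q" "y \<in> torus_proj ` E" unfolding U_def by blast
        then show "y \<in> torus_proj ` (V \<inter> E)" using isoV[of q] by auto
      qed (auto simp: U_def)
      then have "\<psi> ` (torus_proj ` E \<inter> U) = (\<lambda>q. \<psi> (torus_proj q)) ` (V \<inter> E)"
        by (simp only: image_image)
      also have "\<dots> = A ` (V \<inter> E)" using \<psi> by (intro image_cong) auto
      finally show ?thesis .
    qed
    have chart: "affine_chart \<psi> U"
      unfolding affine_chart_def
    proof (intro exI conjI)
      show "open V" by (simp add: V_def)
      show "\<forall>q\<in>V. \<psi> (torus_proj q) = F q + - F p" using \<psi> by (simp add: A_def)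
    qed (use injV F_lin F_bij U_def in auto)
    have "L \<inter> U = torus_proj ` {q \<in> V. (q - p) \<bullet> n = 0}"
    proof (intro equalityI subsetI)
      fix y assume "y \<in> L \<inter> U"
      then obtain q t k where q: "q \<in> V" "y = torus_proj q" "k \<in> int_lattice" "q = p + t *\<^sub>R v + k"
        unfolding U_def L using mem_torus_line_proj by blast
      have "(q - p) \<bullet> n = k \<bullet> n" using n by (simp add: q(4) inner_add_left inner_commute[of v])
      moreover have "\<not> 0 < k \<bullet> n" "\<not> 0 < - k \<bullet> n"
        using gap[OF q(3)] gap[of "- k"] q(3) small_n[OF q(1)] \<rho>(1,6) W calculation by auto
      ultimately show "y \<in> torus_proj ` {q \<in> V. (q - p) \<bullet> n = 0}" using q by auto
    next
      fix y assume "y \<in> torus_proj ` {q \<in> V. (q - p) \<bullet> n = 0}"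
      then obtain q where q: "q \<in> V" "(q - p) \<bullet> n = 0" "y = torus_proj q" by blast
      then have "q - p = ((q - p) \<bullet> v) *\<^sub>R v" using orthonormal_expansion[OF v n, of "q - p"] by simp
      then have "q = p + ((q - p) \<bullet> v) *\<^sub>R v + 0" by (metis add.right_neutral add.commute diff_add_cancel)
      then have "y \<in> L" unfolding L q(3) mem_torus_line_proj using int_lattice_0 by blast
      with q show "y \<in> L \<inter> U" by (auto simp: U_def)
    qed
    then have "\<psi> ` (L \<inter> U) = (\<lambda>q. \<psi> (torus_proj q)) ` {q \<in> V. (q - p) \<bullet> n = 0}"
      by (simp only: image_image)
    also have "\<dots> = A ` {q \<in> V. (q - p) \<bullet> n = 0}" using \<psi> by (intro image_cong) auto
    finally have "\<psi> ` (L \<inter> U) = A ` {q \<in> V. (q - p) \<bullet> n = 0}" .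
    then have line: "\<psi> ` (L \<inter> U) = {u \<in> \<psi> ` U. u $ 1 = 0}" using l by (auto simp: \<psi>U A1)
    have F_sub: "contact_inner 2 2 (\<psi> ` U) \<inter> {u. u $ 1 \<ge> 0 \<and> u $ 2 \<ge> 0} \<subseteq> \<psi> ` (torus_proj ` E \<inter> U)"
    proof
      fix u assume u: "u \<in> contact_inner 2 2 (\<psi> ` U) \<inter> {u. u $ 1 \<ge> 0 \<and> u $ 2 \<ge> 0}"
      then obtain q where q: "q \<in> V" "u = A q" by (auto simp: contact_inner_def \<psi>U)
      have "q \<noteq> p" using u A0 q by (auto simp: contact_inner_def)
      moreover have "((q - p) \<bullet> w)\<^sup>2 / 2 \<le> l * ((q - p) \<bullet> n)"
      proof -
        have "inverse 2 * (u $ 2)\<^sup>2 \<le> \<bar>u $ 1\<bar>" "0 \<le> u $ 1" using u by (auto simp: contact_inner_def abs_powr_2)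
        then have "(u $ 2)\<^sup>2 / 2 \<le> u $ 1" by simp
        then show ?thesis unfolding q(2) A1 A2 .
      qed
      ultimately have "q \<in> E" using inner[OF small[OF q(1)]] by blast
      with q show "u \<in> \<psi> ` (torus_proj ` E \<inter> U)" by (auto simp: \<psi>D)
    qed
    have D_sub: "\<psi> ` (torus_proj ` E \<inter> U) \<subseteq> contact_outer 2 8 (\<psi> ` U) \<inter> {u. u $ 1 \<ge> 0}"
    proof
      fix u assume "u \<in> \<psi> ` (torus_proj ` E \<inter> U)"
      then obtain q where q: "q \<in> V" "q \<in> E" "u = A q" by (auto simp: \<psi>D)
      have pos: "0 \<le> l * ((q - p) \<bullet> n)" using half[OF q(2)] l by simp
      with outer[OF small[OF q(1)] q(2)] have "(u $ 2)\<^sup>2 \<le> 8 * \<bar>u $ 1\<bar>" "0 \<le> u $ 1"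
        unfolding q(3) A1 A2 by simp_all
      moreover have "u \<in> \<psi> ` U" using q by (auto simp: \<psi>U)
      ultimately show "u \<in> contact_outer 2 8 (\<psi> ` U) \<inter> {u. u $ 1 \<ge> 0}"
        by (simp add: contact_outer_def abs_powr_2)
    qed
    have z0: "torus_proj p \<in> U" "\<psi> (torus_proj p) = 0"
      using pV \<psi>[OF pV] A0 by (auto simp: U_def)
    show "\<exists>\<psi> U C\<^sub>i\<^sub>n C\<^sub>o\<^sub>u\<^sub>t. affine_chart \<psi> U \<and> torus_proj p \<in> U \<and> \<psi> (torus_proj p) = 0 \<and>
        \<psi> ` (L \<inter> U) = {q \<in> \<psi> ` U. q $ 1 = 0} \<and> C\<^sub>o\<^sub>u\<^sub>t > C\<^sub>i\<^sub>n \<and> C\<^sub>i\<^sub>n > 1 \<and>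
        contact_inner 2 C\<^sub>i\<^sub>n (\<psi> ` U) \<inter> {q. q $ 1 \<ge> 0 \<and> q $ 2 \<ge> 0} \<subseteq> \<psi> ` (torus_proj ` E \<inter> U) \<and>
        \<psi> ` (torus_proj ` E \<inter> U) \<subseteq> contact_outer 2 C\<^sub>o\<^sub>u\<^sub>t (\<psi> ` U) \<inter> {q. q $ 1 \<ge> 0}"
      by (rule exI[of _ \<psi>], rule exI[of _ U], rule exI[of _ 2], rule exI[of _ 8])
         (intro conjI chart z0 line F_sub D_sub; simp)
  qed
  show ?thesis
    unfolding has_order_def Let_def
    using gl zL z_frontier contact one_side
    by (simp add: p_def[symmetric] E_def[symmetric])
qed

lemma glancing_tangent_integer_direction:
  assumes \<gamma>: "\<gamma> \<in> regular_curves" and gl: "glancing_line (torus_proj ` enclosed \<gamma>) L"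
    and zL: "torus_proj (\<gamma> \<sigma>) \<in> L" and "0 < W"
    and wide: "\<And>n. norm n = 1 \<Longrightarrow> \<exists>\<alpha> \<beta>. W \<le> (\<gamma> \<alpha> - \<gamma> \<beta>) \<bullet> n"
  obtains m where "m \<in> int_lattice" "m \<noteq> 0" "norm m * W \<le> 1" "perp (circle_deriv \<gamma> \<sigma>) \<bullet> m = 0"
proof -
  note R = regular_curve_region[OF \<gamma>]
  define p where "p = \<gamma> \<sigma>"
  obtain v where dir: "line_direction L v" using gl by (auto simp: glancing_line_def)
  then have v: "norm v = 1" by (simp add: line_direction_def)
  have L: "L = torus_line (torus_proj p) v"
    using torus_line_through[OF dir zL] by (simp add: p_def)
  have avoid: "torus_line (torus_proj p) v \<inter> torus_proj ` enclosed \<gamma> = {}"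
    using gl by (simp add: glancing_line_def L)
  obtain n where n: "norm n = 1" "n \<bullet> v = 0" and half: "\<And>x. x \<in> enclosed \<gamma> \<Longrightarrow> (x - p) \<bullet> n > 0"
    using avoiding_region_halfplane[OF avoid v R(6)] by blast
  have "closure (enclosed \<gamma>) \<subseteq> {x. n \<bullet> x \<ge> n \<bullet> p}"
    by (rule closure_minimal[OF _ closed_halfspace_ge])
       (use half in \<open>fastforce simp: inner_diff_left inner_diff_right inner_commute\<close>)
  then have pos: "(\<gamma> \<theta> - p) \<bullet> n \<ge> 0" for \<theta>
    using R(11)[of \<theta>] by (auto simp: inner_diff_left inner_diff_right inner_commute)
  obtain \<alpha> \<beta> where "W \<le> (\<gamma> \<alpha> - \<gamma> \<beta>) \<bullet> n" using wide n by blast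
  also have "\<dots> = (\<gamma> \<alpha> - p) \<bullet> n - (\<gamma> \<beta> - p) \<bullet> n" by (simp add: inner_diff_left)
  finally have W_le: "W \<le> (\<gamma> \<alpha> - p) \<bullet> n" using pos[of \<beta>] by linarith
  have "\<not> (0 < k \<bullet> n \<and> k \<bullet> n < W)" if "k \<in> int_lattice" for k
    using avoiding_region_gap[OF avoid v R(6) n _ R(11)[of \<alpha>] that] R(11)[of \<sigma>] W_le by (auto simp: p_def)
  then obtain m where m: "m \<in> int_lattice" "m \<noteq> 0" "m \<bullet> n = 0" "norm m * W \<le> 1"
    using lattice_gap_imp_integer_direction[OF n(1) \<open>0 < W\<close>] by blast
  have tangent: "circle_deriv \<gamma> \<sigma> \<bullet> n = 0"
    using supported_curve_derivatives(1)[OF R(1)] pos by (simp add: p_def)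
  have "circle_deriv \<gamma> \<sigma> = (circle_deriv \<gamma> \<sigma> \<bullet> v) *\<^sub>R v" "m = (m \<bullet> v) *\<^sub>R v"
    using orthonormal_expansion[OF v n, of "circle_deriv \<gamma> \<sigma>"] orthonormal_expansion[OF v n, of m] tangent m
    by simp_all
  then obtain c d where "circle_deriv \<gamma> \<sigma> = c *\<^sub>R v" "m = d *\<^sub>R v" by blast
  then have "perp (circle_deriv \<gamma> \<sigma>) \<bullet> m = 0" by (simp add: inner_2) (simp add: perp_def)
  with m show thesis using that by blast
qed

section \<open>Curves whose integer tangents are curved\<close>

definition width_ge :: "(circle \<Rightarrow> real^2) \<Rightarrow> real \<Rightarrow> bool" where
  "width_ge \<gamma> W \<longleftrightarrow> (\<forall>n. norm n = 1 \<longrightarrow> (\<exists>\<alpha> \<beta>. W \<le> (\<gamma> \<alpha> - \<gamma> \<beta>) \<bullet> n))"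

definition curved_at_tangents_to :: "(circle \<Rightarrow> real^2) \<Rightarrow> real^2 \<Rightarrow> bool" where
  "curved_at_tangents_to \<gamma> m \<longleftrightarrow> (\<forall>\<theta>. perp (circle_deriv \<gamma> \<theta>) \<bullet> m = 0 \<longrightarrow> curve_det \<gamma> \<theta> \<noteq> 0)"

text \<open>The strict inequality between \<open>r\<close> and the width \<open>W\<close> makes the condition stable under small perturbations, which may
reduce the width.\<close>

definition nondegenerate_curves :: "(circle \<Rightarrow> real^2) set" where
  "nondegenerate_curves = {\<gamma> \<in> regular_curves. \<exists>r W. 0 < r \<and> r < W \<and> width_ge \<gamma> W \<and>
     (\<forall>m\<in>int_lattice. m \<noteq> 0 \<longrightarrow> norm m * r \<le> 1 \<longrightarrow> curved_at_tangents_to \<gamma> m)}"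

lemma nondegenerate_glancing_point_curved:
  assumes "\<gamma> \<in> nondegenerate_curves" and gl: "glancing_line (torus_proj ` enclosed \<gamma>) L"
    and zL: "torus_proj (\<gamma> \<sigma>) \<in> L"
  shows "curve_det \<gamma> \<sigma> \<noteq> 0"
proof -
  obtain r W where \<gamma>: "\<gamma> \<in> regular_curves" and r: "0 < r" "r < W" "width_ge \<gamma> W"
    and curved: "\<And>m. m \<in> int_lattice \<Longrightarrow> m \<noteq> 0 \<Longrightarrow> norm m * r \<le> 1 \<Longrightarrow> curved_at_tangents_to \<gamma> m"
    using assms(1) unfolding nondegenerate_curves_def by blast
  have "0 < W" using r by simp
  obtain m where m: "m \<in> int_lattice" "m \<noteq> 0" "norm m * W \<le> 1" "perp (circle_deriv \<gamma> \<sigma>) \<bullet> m = 0"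
    using glancing_tangent_integer_direction[OF \<gamma> gl zL \<open>0 < W\<close>] r(3) unfolding width_ge_def by metis
  have "norm m * r \<le> norm m * W" using r by (intro mult_left_mono) auto
  then have "norm m * r \<le> 1" using m(3) by (rule order_trans)
  then have "curved_at_tangents_to \<gamma> m" by (rule curved[OF m(1,2)])
  with m(4) show ?thesis by (simp add: curved_at_tangents_to_def)
qed

lemma C2_dist_bounds:
  assumes "C2_curve \<gamma>" "C2_curve \<delta>"
  shows "norm (\<gamma> \<theta> - \<delta> \<theta>) \<le> C2_dist \<gamma> \<delta>"
    and "norm (circle_deriv \<gamma> \<theta> - circle_deriv \<delta> \<theta>) \<le> C2_dist \<gamma> \<delta>"
    and "norm (circle_deriv (circle_deriv \<gamma>) \<theta> - circle_deriv (circle_deriv \<delta>) \<theta>) \<le> C2_dist \<gamma> \<delta>"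
proof -
  note A = C2_curve_bounded[OF assms(1)] and B = C2_curve_bounded[OF assms(2)]
  note S = sup_dist_facts(1)[OF A(1) B(1) B(1), of \<theta>] sup_dist_facts(2)[OF A(1) B(1) B(1)]
    sup_dist_facts(1)[OF A(2) B(2) B(2), of \<theta>] sup_dist_facts(2)[OF A(2) B(2) B(2)]
    sup_dist_facts(1)[OF A(3) B(3) B(3), of \<theta>] sup_dist_facts(2)[OF A(3) B(3) B(3)]
  show "norm (\<gamma> \<theta> - \<delta> \<theta>) \<le> C2_dist \<gamma> \<delta>"
    and "norm (circle_deriv \<gamma> \<theta> - circle_deriv \<delta> \<theta>) \<le> C2_dist \<gamma> \<delta>"
    and "norm (circle_deriv (circle_deriv \<gamma>) \<theta> - circle_deriv (circle_deriv \<delta>) \<theta>) \<le> C2_dist \<gamma> \<delta>"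
    using S assms unfolding C2_dist_def dist_norm by simp_all
qed

lemma continuous_on_perp [continuous_intros]:
  "continuous_on S f \<Longrightarrow> continuous_on S (\<lambda>x. perp (f x))"
  using bounded_linear.continuous_on linear_perp linear_conv_bounded_linear by blast

lemma C2_curve_continuous:
  assumes "C2_curve \<gamma>"
  shows "continuous_on UNIV (circle_deriv \<gamma>)" "continuous_on UNIV (circle_deriv (circle_deriv \<gamma>))"
    "continuous_on UNIV (curve_det \<gamma>)"
proof -
  show 1: "continuous_on UNIV (circle_deriv \<gamma>)" "continuous_on UNIV (circle_deriv (circle_deriv \<gamma>))"
    using assms circle_differentiable_imp_continuous by (auto simp: C2_curve_def)
  then show "continuous_on UNIV (curve_det \<gamma>)"
    unfolding curve_det_def[abs_def] by (intro continuous_intros)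
qed

text \<open>On the compact circle \<open>\<bar>perp \<gamma>' \<bullet> m\<bar> + \<bar>det (\<gamma>', \<gamma>'')\<bar>\<close> has a positive minimum, and a \<open>C\<^sup>2\<close>-small
perturbation cannot bring it down to zero.\<close>

lemma curved_at_tangents_to_open:
  assumes \<gamma>: "C2_curve \<gamma>" and curved: "curved_at_tangents_to \<gamma> m"
  shows "\<forall>\<^sub>F \<epsilon> in at_right 0. \<forall>\<delta>. C2_curve \<delta> \<longrightarrow> C2_dist \<gamma> \<delta> < \<epsilon> \<longrightarrow> curved_at_tangents_to \<delta> m"
proof -
  let ?f = "\<lambda>\<theta>. \<bar>perp (circle_deriv \<gamma> \<theta>) \<bullet> m\<bar> + \<bar>curve_det \<gamma> \<theta>\<bar>"
  have "continuous_on UNIV ?f" by (intro continuous_intros C2_curve_continuous[OF \<gamma>])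
  then obtain \<theta>0 where "\<And>\<theta>. ?f \<theta>0 \<le> ?f \<theta>"
    using continuous_attains_inf[OF compact_circle, of ?f] by auto
  moreover define \<mu> where "\<mu> = ?f \<theta>0"
  ultimately have \<mu>: "\<And>\<theta>. \<mu> \<le> ?f \<theta>" by simp
  have "\<mu> > 0"
  proof (cases "perp (circle_deriv \<gamma> \<theta>0) \<bullet> m = 0")
    case True
    then show ?thesis using curved by (simp add: \<mu>_def curved_at_tangents_to_def)
  qed (simp add: \<mu>_def add_pos_nonneg)
  obtain B1 B2 where B: "\<And>\<theta>. norm (circle_deriv \<gamma> \<theta>) \<le> B1" "\<And>\<theta>. norm (circle_deriv (circle_deriv \<gamma>) \<theta>) \<le> B2"
    using C2_curve_bounded[OF \<gamma>] unfolding bounded_iff by blast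
  have B0: "0 \<le> B1" "0 \<le> B2" using B norm_ge_zero order_trans by blast+
  define C where "C = norm m + B1 + B2 + 1"
  have C: "0 < C" using B0 by (simp add: C_def add_nonneg_pos)
  define e where "e = min 1 (\<mu> / C)"
  have "0 < e" using \<open>\<mu> > 0\<close> C by (simp add: e_def)
  have main: "curved_at_tangents_to \<delta> m" if \<delta>: "C2_curve \<delta>" and d: "C2_dist \<gamma> \<delta> < e" for \<delta>
    unfolding curved_at_tangents_to_def
  proof (intro allI impI notI)
    fix \<theta> assume z: "perp (circle_deriv \<delta> \<theta>) \<bullet> m = 0" "curve_det \<delta> \<theta> = 0"
    let ?d = "C2_dist \<gamma> \<delta>"
    let ?u = "circle_deriv \<gamma> \<theta>" and ?v = "circle_deriv \<delta> \<theta>"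
    let ?a = "circle_deriv (circle_deriv \<gamma>) \<theta>" and ?b = "circle_deriv (circle_deriv \<delta>) \<theta>"
    have uv: "norm (?u - ?v) \<le> ?d" "norm (?a - ?b) \<le> ?d" and d0: "0 \<le> ?d"
      using C2_dist_bounds[OF \<gamma> \<delta>, of \<theta>] norm_ge_zero order_trans by blast+
    have "norm ?v \<le> norm ?u + norm (?u - ?v)" by (metis norm_minus_commute norm_triangle_sub)
    then have v: "norm ?v \<le> B1 + 1" using uv B(1)[of \<theta>] d by (simp add: e_def)
    have "\<bar>perp ?u \<bullet> m\<bar> = \<bar>perp (?u - ?v) \<bullet> m\<bar>" using z by (simp add: perp_diff inner_diff_left)
    also have "\<dots> \<le> norm (perp (?u - ?v)) * norm m" by (rule Cauchy_Schwarz_ineq2)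
    also have "\<dots> \<le> ?d * norm m" using uv by (simp add: mult_right_mono)
    finally have 1: "\<bar>perp ?u \<bullet> m\<bar> \<le> ?d * norm m" .
    have "curve_det \<gamma> \<theta> = perp (?u - ?v) \<bullet> ?a + perp ?v \<bullet> (?a - ?b)"
      using z by (simp add: curve_det_def perp_diff inner_diff_left inner_diff_right)
    then have "\<bar>curve_det \<gamma> \<theta>\<bar> \<le> \<bar>perp (?u - ?v) \<bullet> ?a\<bar> + \<bar>perp ?v \<bullet> (?a - ?b)\<bar>" by simp
    also have "\<dots> \<le> norm (?u - ?v) * norm ?a + norm ?v * norm (?a - ?b)"
      using Cauchy_Schwarz_ineq2[of "perp (?u - ?v)" ?a] Cauchy_Schwarz_ineq2[of "perp ?v" "?a - ?b"] by simp
    also have "\<dots> \<le> ?d * B2 + (B1 + 1) * ?d"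
      using uv v B(2)[of \<theta>] d0 B0 by (intro add_mono mult_mono) auto
    finally have "?f \<theta> \<le> ?d * C" using 1 by (simp add: C_def algebra_simps)
    moreover have "?d < \<mu> / C" using d by (simp add: e_def)
    then have "?d * C < \<mu>" using C by (simp add: pos_less_divide_eq)
    ultimately show False using \<mu>[of \<theta>] by simp
  qed
  show ?thesis
    unfolding eventually_at_right_field
    using \<open>0 < e\<close> main by (intro exI[of _ e]) auto
qed

lemma nondegenerate_curves_C2_nhds:
  assumes "\<gamma> \<in> nondegenerate_curves"
  obtains \<epsilon> where "0 < \<epsilon>" "\<And>\<delta>. \<delta> \<in> regular_curves \<Longrightarrow> C2_dist \<gamma> \<delta> < \<epsilon> \<Longrightarrow> \<delta> \<in> nondegenerate_curves"
proof -
  obtain r W where \<gamma>: "\<gamma> \<in> regular_curves" and r: "0 < r" "r < W" and width: "width_ge \<gamma> W"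
    and curved: "\<And>m. m \<in> int_lattice \<Longrightarrow> m \<noteq> 0 \<Longrightarrow> norm m * r \<le> 1 \<Longrightarrow> curved_at_tangents_to \<gamma> m"
    using assms(1) unfolding nondegenerate_curves_def by blast
  have C: "C2_curve \<gamma>" using regular_curve_region(1)[OF \<gamma>] .
  define M where "M = {m \<in> int_lattice. m \<noteq> 0 \<and> norm m * r \<le> 1}"
  have "M \<subseteq> int_lattice \<inter> cball 0 (1 / r)" using r by (auto simp: M_def field_simps)
  then have "finite M" using finite_bounded_int_lattice[OF bounded_cball] finite_subset by blast
  then have "\<forall>\<^sub>F \<epsilon> in at_right 0. \<forall>m\<in>M. \<forall>\<delta>. C2_curve \<delta> \<longrightarrow> C2_dist \<gamma> \<delta> < \<epsilon> \<longrightarrow> curved_at_tangents_to \<delta> m"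
    by (rule eventually_ball_finite) (use curved_at_tangents_to_open[OF C] curved in \<open>auto simp: M_def\<close>)
  then obtain e where e: "0 < e" "\<And>\<epsilon>. 0 < \<epsilon> \<Longrightarrow> \<epsilon> < e \<Longrightarrow> 
      \<forall>m\<in>M. \<forall>\<delta>. C2_curve \<delta> \<longrightarrow> C2_dist \<gamma> \<delta> < \<epsilon> \<longrightarrow> curved_at_tangents_to \<delta> m"
    unfolding eventually_at_right_field by auto
  define \<epsilon> where "\<epsilon> = min (e / 2) ((W - r) / 4)"
  have \<epsilon>: "0 < \<epsilon>" "\<epsilon> < e" using e r by (auto simp: \<epsilon>_def)
  show thesis
  proof (rule that[OF \<epsilon>(1)])
    fix \<delta> assume \<delta>: "\<delta> \<in> regular_curves" "C2_dist \<gamma> \<delta> < \<epsilon>"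
    have C': "C2_curve \<delta>" using regular_curve_region(1)[OF \<delta>(1)] .
    have "width_ge \<delta> ((W + r) / 2)"
      unfolding width_ge_def
    proof (intro allI impI)
      fix n :: "real^2" assume n: "norm n = 1"
      then obtain \<alpha> \<beta> where W: "W \<le> (\<gamma> \<alpha> - \<gamma> \<beta>) \<bullet> n" using width by (auto simp: width_ge_def)
      have close: "\<bar>(\<gamma> \<theta> - \<delta> \<theta>) \<bullet> n\<bar> \<le> (W - r) / 4" for \<theta>
        using Cauchy_Schwarz_ineq2[of "\<gamma> \<theta> - \<delta> \<theta>" n] C2_dist_bounds(1)[OF C C', of \<theta>] \<delta>(2) n
        by (simp add: \<epsilon>_def)
      have "(\<delta> \<alpha> - \<delta> \<beta>) \<bullet> n = (\<gamma> \<alpha> - \<gamma> \<beta>) \<bullet> n - (\<gamma> \<alpha> - \<delta> \<alpha>) \<bullet> n + (\<gamma> \<beta> - \<delta> \<beta>) \<bullet> n"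
        by (simp add: inner_diff_left)
      then have "(W + r) / 2 \<le> (\<delta> \<alpha> - \<delta> \<beta>) \<bullet> n" using W close[of \<alpha>] close[of \<beta>] by (simp add: field_simps)
      then show "\<exists>\<alpha> \<beta>. (W + r) / 2 \<le> (\<delta> \<alpha> - \<delta> \<beta>) \<bullet> n" by blast
    qed
    moreover have "curved_at_tangents_to \<delta> m" if "m \<in> int_lattice" "m \<noteq> 0" "norm m * r \<le> 1" for m
      using e(2)[OF \<epsilon>] C' \<delta>(2) that by (auto simp: M_def)
    ultimately show "\<delta> \<in> nondegenerate_curves"
      unfolding nondegenerate_curves_def using \<delta>(1) r
      by (intro CollectI conjI exI[of _ r] exI[of _ "(W + r) / 2"]) auto
  qed
qed

lemma openin_nondegenerate_curves: "openin (subtopology C2_topology regular_curves) nondegenerate_curves"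
proof (subst openin_subopen, intro ballI)
  fix \<gamma> assume \<gamma>: "\<gamma> \<in> nondegenerate_curves"
  interpret C2: Metric_space "Collect C2_curve" C2_dist by (rule Metric_space_C2)
  obtain \<epsilon> where \<epsilon>: "0 < \<epsilon>" "\<And>\<delta>. \<delta> \<in> regular_curves \<Longrightarrow> C2_dist \<gamma> \<delta> < \<epsilon> \<Longrightarrow> \<delta> \<in> nondegenerate_curves"
    using nondegenerate_curves_C2_nhds[OF \<gamma>] by blast
  have reg: "\<gamma> \<in> regular_curves" "\<gamma> \<in> Collect C2_curve"
    using \<gamma> by (auto simp: nondegenerate_curves_def regular_curves_def)
  show "\<exists>T. openin (subtopology C2_topology regular_curves) T \<and> \<gamma> \<in> T \<and> T \<subseteq> nondegenerate_curves"
  proof (intro exI conjI)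
    show "openin (subtopology C2_topology regular_curves) (C2.mball \<gamma> \<epsilon> \<inter> regular_curves)"
      unfolding C2_topology_def openin_subtopology using C2.openin_mball by blast
    show "\<gamma> \<in> C2.mball \<gamma> \<epsilon> \<inter> regular_curves" using reg \<epsilon> by simp
    show "C2.mball \<gamma> \<epsilon> \<inter> regular_curves \<subseteq> nondegenerate_curves" using \<epsilon>(2) by auto
  qed
qed

text \<open>The region contains a ball, and it lies in every half-plane that contains the curve.\<close>

lemma regular_curve_width:
  assumes "\<gamma> \<in> regular_curves"
  obtains W where "0 < W" "width_ge \<gamma> W"
proof -
  note R = regular_curve_region[OF assms]
  obtain x r where r: "0 < r" "ball x r \<subseteq> enclosed \<gamma>"
    using R(4,5) by (metis all_not_in_conv open_contains_ball)
  have "width_ge \<gamma> r" unfolding width_ge_def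
  proof (intro allI impI)
    fix n :: "real^2" assume n: "norm n = 1"
    have cont: "continuous_on UNIV (\<lambda>\<theta>. n \<bullet> \<gamma> \<theta>)" by (intro continuous_intros R(2))
    obtain \<alpha> where \<alpha>: "\<And>\<theta>. n \<bullet> \<gamma> \<theta> \<le> n \<bullet> \<gamma> \<alpha>"
      using continuous_attains_sup[OF compact_circle _ cont] by auto
    obtain \<beta> where \<beta>: "\<And>\<theta>. n \<bullet> \<gamma> \<beta> \<le> n \<bullet> \<gamma> \<theta>"
      using continuous_attains_inf[OF compact_circle _ cont] by auto
    have sub: "enclosed \<gamma> \<subseteq> {y. n \<bullet> y \<le> n \<bullet> \<gamma> \<alpha>}" "enclosed \<gamma> \<subseteq> {y. n \<bullet> y \<ge> n \<bullet> \<gamma> \<beta>}"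
    proof -
      have hull: "enclosed \<gamma> \<subseteq> T" if "convex T" "range \<gamma> \<subseteq> T" for T
        using inside_mono[OF that(2)] inside_convex[OF that(1)] by (auto simp: enclosed_def)
      show "enclosed \<gamma> \<subseteq> {y. n \<bullet> y \<le> n \<bullet> \<gamma> \<alpha>}" by (rule hull[OF convex_halfspace_le]) (use \<alpha> in auto)
      show "enclosed \<gamma> \<subseteq> {y. n \<bullet> y \<ge> n \<bullet> \<gamma> \<beta>}" by (rule hull[OF convex_halfspace_ge]) (use \<beta> in auto)
    qed
    have "x + (r / 2) *\<^sub>R n \<in> ball x r" "x - (r / 2) *\<^sub>R n \<in> ball x r"
      using r n by (simp_all add: dist_norm)
    then have "n \<bullet> (x + (r / 2) *\<^sub>R n) \<le> n \<bullet> \<gamma> \<alpha>" "n \<bullet> (x - (r / 2) *\<^sub>R n) \<ge> n \<bullet> \<gamma> \<beta>"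
      using r(2) sub by blast+
    then have "r \<le> n \<bullet> (\<gamma> \<alpha> - \<gamma> \<beta>)"
      using n by (simp add: inner_add_right inner_diff_right norm_eq_1)
    then have "r \<le> (\<gamma> \<alpha> - \<gamma> \<beta>) \<bullet> n" by (simp only: inner_commute)
    then show "\<exists>\<alpha> \<beta>. r \<le> (\<gamma> \<alpha> - \<gamma> \<beta>) \<bullet> n" by blast
  qed
  with r that show thesis by blast
qed

section \<open>Rotated curves\<close>

lemma rotation_of_angle:
  "rotation (of_angle t) x = vector [cos t * x $ 1 - sin t * x $ 2, sin t * x $ 1 + cos t * x $ 2]"
  by (simp add: rotation.abs_eq)

lemma rotation_inverse:
  obtains \<theta>' where "\<And>x. rotation \<theta> (rotation \<theta>' x) = x" "\<And>x. rotation \<theta>' (rotation \<theta> x) = x"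
proof (rule that[of "of_angle (- rep_angle \<theta>)"])
  define t where "t = rep_angle \<theta>"
  have th: "\<theta> = of_angle t" by (simp add: t_def)
  have cs: "cos t * cos t + sin t * sin t = 1" using sin_cos_squared_add3[of t] .
  show "rotation \<theta> (rotation (of_angle (- rep_angle \<theta>)) x) = x" for x
    unfolding t_def[symmetric] unfolding th vec_eq_iff forall_2
    by (simp add: rotation_of_angle) (intro conjI; use cs in algebra)
  show "rotation (of_angle (- rep_angle \<theta>)) (rotation \<theta> x) = x" for x
    unfolding t_def[symmetric] unfolding th vec_eq_iff forall_2
    by (simp add: rotation_of_angle) (intro conjI; use cs in algebra)
qed

lemma linear_rotation: "linear (rotation \<theta>)"
proof -
  define t where "t = rep_angle \<theta>"
  have th: "\<theta> = of_angle t" by (simp add: t_def)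
  show ?thesis unfolding th
    by (rule linearI) (simp_all add: rotation_of_angle vec_eq_iff forall_2 algebra_simps)
qed

lemma rotation_inner: "rotation \<theta> x \<bullet> rotation \<theta> y = x \<bullet> y"
proof -
  define t where "t = rep_angle \<theta>"
  have th: "\<theta> = of_angle t" by (simp add: t_def)
  have cs: "cos t * cos t + sin t * sin t = 1" using sin_cos_squared_add3[of t] .
  show ?thesis unfolding th inner_2 by (simp add: rotation_of_angle) (use cs in algebra)
qed

lemma norm_rotation [simp]: "norm (rotation \<theta> x) = norm x"
  by (simp add: norm_eq_sqrt_inner rotation_inner)

lemma bij_rotation: "bij (rotation \<theta>)"
  by (metis bij_betw_def inj_on_inverseI rotation_inverse surjI)

lemma perp_rotation: "perp (rotation \<theta> x) = rotation \<theta> (perp x)"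
proof -
  define t where "t = rep_angle \<theta>"
  have th: "\<theta> = of_angle t" by (simp add: t_def)
  show ?thesis unfolding th by (simp add: rotation_of_angle perp_def vec_eq_iff forall_2)
qed

lemma bounded_linear_rotation: "bounded_linear (rotation \<theta>)"
  using linear_rotation linear_conv_bounded_linear by blast

lemma rotated_circle_differentiable:
  assumes "circle_differentiable \<gamma>"
  shows "circle_differentiable (rotation \<theta> \<circ> \<gamma>)" "circle_deriv (rotation \<theta> \<circ> \<gamma>) = rotation \<theta> \<circ> circle_deriv \<gamma>"
proof -
  have "((\<lambda>t. \<gamma> (of_angle t)) has_vector_derivative circle_deriv \<gamma> (of_angle t)) (at t)" for t
    using assms unfolding circle_differentiable_def circle_deriv_of_angle
    by (simp add: vector_derivative_works[symmetric])
  then have D: "((\<lambda>t. rotation \<theta> (\<gamma> (of_angle t))) has_vector_derivative rotation \<theta> (circle_deriv \<gamma> (of_angle t))) (at t)" for t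
    by (rule bounded_linear.has_vector_derivative[OF bounded_linear_rotation])
  then show "circle_differentiable (rotation \<theta> \<circ> \<gamma>)"
    unfolding circle_differentiable_def o_def using differentiableI_vector by blast
  show "circle_deriv (rotation \<theta> \<circ> \<gamma>) = rotation \<theta> \<circ> circle_deriv \<gamma>"
  proof
    fix \<sigma>
    have "circle_deriv (rotation \<theta> \<circ> \<gamma>) (of_angle (rep_angle \<sigma>)) = rotation \<theta> (circle_deriv \<gamma> (of_angle (rep_angle \<sigma>)))"
      using vector_derivative_at[OF D] unfolding circle_deriv_of_angle[of "rotation \<theta> \<circ> \<gamma>"] by (simp add: o_def)
    then show "circle_deriv (rotation \<theta> \<circ> \<gamma>) \<sigma> = (rotation \<theta> \<circ> circle_deriv \<gamma>) \<sigma>" by simp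
  qed
qed

lemma rotated_C2_curve:
  assumes "C2_curve \<gamma>"
  shows "C2_curve (rotation \<theta> \<circ> \<gamma>)"
    and "circle_deriv (rotation \<theta> \<circ> \<gamma>) = rotation \<theta> \<circ> circle_deriv \<gamma>"
    and "circle_deriv (circle_deriv (rotation \<theta> \<circ> \<gamma>)) = rotation \<theta> \<circ> circle_deriv (circle_deriv \<gamma>)"
    and "curve_det (rotation \<theta> \<circ> \<gamma>) = curve_det \<gamma>"
proof -
  have D: "circle_differentiable \<gamma>" "circle_differentiable (circle_deriv \<gamma>)"
    and c: "continuous_on UNIV (circle_deriv (circle_deriv \<gamma>))"
    using assms by (auto simp: C2_curve_def)
  show 1: "circle_deriv (rotation \<theta> \<circ> \<gamma>) = rotation \<theta> \<circ> circle_deriv \<gamma>"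
    using rotated_circle_differentiable(2)[OF D(1)] .
  show 2: "circle_deriv (circle_deriv (rotation \<theta> \<circ> \<gamma>)) = rotation \<theta> \<circ> circle_deriv (circle_deriv \<gamma>)"
    unfolding 1 using rotated_circle_differentiable(2)[OF D(2)] .
  have "continuous_on UNIV (rotation \<theta> \<circ> circle_deriv (circle_deriv \<gamma>))"
    unfolding o_def by (rule bounded_linear.continuous_on[OF bounded_linear_rotation c])
  then show "C2_curve (rotation \<theta> \<circ> \<gamma>)"
    unfolding C2_curve_def 2 unfolding 1 using rotated_circle_differentiable(1)[OF D(1)]
      rotated_circle_differentiable(1)[OF D(2)] by blast
  show "curve_det (rotation \<theta> \<circ> \<gamma>) = curve_det \<gamma>"
    by (rule ext) (simp add: curve_det_def 1 2[unfolded 1] perp_rotation rotation_inner)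
qed

lemma enclosed_rotation: "enclosed (rotation \<theta> \<circ> \<gamma>) = rotation \<theta> ` enclosed \<gamma>"
  unfolding enclosed_def image_comp[symmetric] by (rule inside_bij_linear_image[OF linear_rotation bij_rotation])

lemma rotated_regular_curve:
  assumes \<gamma>: "\<gamma> \<in> regular_curves" and \<theta>: "\<theta> \<in> proper_angles (enclosed \<gamma>)"
  shows "rotation \<theta> \<circ> \<gamma> \<in> regular_curves"
proof -
  have "C2_curve \<gamma>" "inj \<gamma>" and nz: "\<And>\<sigma>. circle_deriv \<gamma> \<sigma> \<noteq> 0" using \<gamma> by (auto simp: regular_curves_def)
  note R = rotated_C2_curve[OF \<open>C2_curve \<gamma>\<close>, of \<theta>]
  have "circle_deriv (rotation \<theta> \<circ> \<gamma>) \<sigma> \<noteq> 0" for \<sigma>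
    using nz[of \<sigma>] norm_rotation[of \<theta> "circle_deriv \<gamma> \<sigma>"] by (auto simp: R(2) simp del: norm_rotation)
  moreover have "inj (rotation \<theta> \<circ> \<gamma>)"
    using \<open>inj \<gamma>\<close> bij_rotation by (simp add: inj_compose bij_is_inj)
  ultimately show ?thesis
    using \<theta> R(1) by (auto simp: regular_curves_def enclosed_rotation proper_angles_def)
qed

lemma width_ge_rotation:
  assumes "width_ge \<gamma> W"
  shows "width_ge (rotation \<theta> \<circ> \<gamma>) W"
  unfolding width_ge_def
proof (intro allI impI)
  fix n :: "real^2" assume n: "norm n = 1"
  obtain \<theta>' where inv: "\<And>x. rotation \<theta> (rotation \<theta>' x) = x" using rotation_inverse by blast
  obtain \<alpha> \<beta> where "W \<le> (\<gamma> \<alpha> - \<gamma> \<beta>) \<bullet> rotation \<theta>' n"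
    using assms n norm_rotation[of \<theta>' n] unfolding width_ge_def by metis
  also have "\<dots> = rotation \<theta> (\<gamma> \<alpha> - \<gamma> \<beta>) \<bullet> n" by (metis inv rotation_inner)
  finally show "\<exists>\<alpha> \<beta>. W \<le> ((rotation \<theta> \<circ> \<gamma>) \<alpha> - (rotation \<theta> \<circ> \<gamma>) \<beta>) \<bullet> n"
    using linear_diff[OF linear_rotation] by (intro exI[of _ \<alpha>] exI[of _ \<beta>]) simp
qed

section \<open>Almost every rotation is nondegenerate\<close>

text \<open>Sard's theorem in dimension one, through the Euclidean spaces \<open>real^1\<close>.\<close>

lemma negligible_critical_values:
  fixes f :: "real \<Rightarrow> real"
  assumes "\<And>x. x \<in> S \<Longrightarrow> (f has_real_derivative 0) (at x within S)"
  shows "negligible (f ` S)"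
proof -
  define F :: "real^1 \<Rightarrow> real^1" where "F = (\<lambda>x. vec (f (x $ 1)))"
  define T :: "(real^1) set" where "T = {x. x $ 1 \<in> S}"
  have "negligible (F ` T)"
  proof (rule baby_Sard)
    show "CARD(1) \<le> CARD(1)" by simp
    fix x assume x: "x \<in> T"
    have "(f has_derivative (\<lambda>h. 0)) (at (x $ 1) within (\<lambda>y. y $ 1) ` T)"
    proof -
      have "(f has_derivative (\<lambda>h. 0)) (at (x $ 1) within S)"
        using assms[of "x $ 1"] x by (simp add: T_def has_field_derivative_def lambda_zero)
      then show ?thesis by (rule has_derivative_subset) (auto simp: T_def)
    qed
    moreover have "((\<lambda>y. y $ 1) has_derivative (\<lambda>h. h $ 1)) (at x within T)"
      by (rule bounded_linear_imp_has_derivative) (rule bounded_linear_vec_nth)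
    ultimately have "((\<lambda>y. f (y $ 1)) has_derivative (\<lambda>h. 0)) (at x within T)"
      using has_derivative_in_compose[of "\<lambda>y. y $ 1" "\<lambda>h. h $ 1" x T f "\<lambda>h. 0"] by simp
    then show "(F has_derivative (\<lambda>h. 0)) (at x within T)"
      unfolding F_def has_derivative_componentwise_within[of "\<lambda>x. vec (f (x $ 1))"]
      by (auto simp: Basis_vec_def inner_axis)
    have "matrix (\<lambda>h::real^1. 0::real^1) = 0" by (simp add: matrix_def vec_eq_iff)
    then show "rank (matrix (\<lambda>h::real^1. 0::real^1)) < CARD(1)" by (simp add: rank_0)
  qed
  then have "negligible ((\<lambda>x. x $ 1) ` F ` T)"
    by (rule negligible_differentiable_image_negligible[rotated])
       (auto intro!: bounded_linear_imp_differentiable_on bounded_linear_vec_nth)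
  moreover have "f ` S \<subseteq> (\<lambda>x. x $ 1) ` F ` T"
  proof
    fix y assume "y \<in> f ` S"
    then obtain s where s: "s \<in> S" "y = f s" by blast
    then have "vec s \<in> T" "F (vec s) $ 1 = y" by (simp_all add: T_def F_def)
    then show "y \<in> (\<lambda>x. x $ 1) ` F ` T" by blast
  qed
  ultimately show ?thesis by (rule negligible_subset)
qed

text \<open>With the velocity as a complex function \<open>G\<close>, an antiderivative \<open>h\<close> of \<open>G' / G\<close> is a logarithm of \<open>G\<close> up to a
constant, because \<open>G exp (- h)\<close> has derivative zero. Its imaginary part is the tangent angle.\<close>

lemma tangent_angle_lift:
  assumes \<gamma>: "C2_curve \<gamma>" and nz: "\<And>\<theta>. circle_deriv \<gamma> \<theta> \<noteq> 0"
  obtains \<phi> where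
    "\<And>t. t \<in> {0..2*pi} \<Longrightarrow> (\<phi> has_real_derivative
        curve_det \<gamma> (of_angle t) / (norm (circle_deriv \<gamma> (of_angle t)))\<^sup>2) (at t within {0..2*pi})"
    "\<And>t. t \<in> {0..2*pi} \<Longrightarrow> \<exists>\<rho>>0. circle_deriv \<gamma> (of_angle t) = vector [\<rho> * cos (\<phi> t), \<rho> * sin (\<phi> t)]"
proof -
  let ?I = "{0..2*pi}"
  let ?c = plane_to_complex
  have bl: "bounded_linear ?c" using linear_plane_to_complex linear_conv_bounded_linear by blast
  define G where "G = (\<lambda>t. ?c (circle_deriv \<gamma> (of_angle t)))"
  define G' where "G' = (\<lambda>t. ?c (circle_deriv (circle_deriv \<gamma>) (of_angle t)))"
  have G: "(G has_vector_derivative G' t) (at t within ?I)" for t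
    unfolding G_def G'_def
    by (rule has_vector_derivative_at_within, rule bounded_linear.has_vector_derivative[OF bl],
        rule C2_curve_has_derivatives(2)[OF \<gamma>])
  have G0: "G t \<noteq> 0" for t
    using nz[of "of_angle t"] bij_is_inj[OF bij_plane_to_complex] linear_0[OF linear_plane_to_complex]
    unfolding G_def by (metis injD)
  have cG: "continuous_on UNIV G" "continuous_on UNIV G'"
    unfolding G_def G'_def
    by (intro bounded_linear.continuous_on[OF bl] continuous_on_compose2[OF C2_curve_continuous(1)[OF \<gamma>] continuous_of_angle]
        continuous_on_compose2[OF C2_curve_continuous(2)[OF \<gamma>] continuous_of_angle]; simp)+
  define h where "h = (\<lambda>t. integral {0..t} (\<lambda>u. G' u / G u))"
  have "continuous_on ?I (\<lambda>u. G' u / G u)"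
    using G0 by (intro continuous_intros continuous_on_subset[OF cG(1)] continuous_on_subset[OF cG(2)]) auto
  then have h: "(h has_vector_derivative G' t / G t) (at t within ?I)" if "t \<in> ?I" for t
    unfolding h_def using that by (rule integral_has_vector_derivative)
  have "((\<lambda>t. G t * exp (- h t)) has_vector_derivative 0) (at t within ?I)" if t: "t \<in> ?I" for t
  proof -
    have "((\<lambda>z. exp (- z)) has_field_derivative - exp (- h t)) (at (h t) within h ` ?I)"
      by (auto intro!: derivative_eq_intros)
    then have "((\<lambda>t. exp (- h t)) has_vector_derivative G' t / G t * (- exp (- h t))) (at t within ?I)"
      using field_vector_diff_chain_within[OF h[OF t]] unfolding o_def by blast
    from has_vector_derivative_mult[OF G this] show ?thesis using G0[of t] by (simp add: field_simps)
  qed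
  then obtain c where c: "\<And>t. t \<in> ?I \<Longrightarrow> G t * exp (- h t) = c"
    using has_vector_derivative_zero_constant[of ?I "\<lambda>t. G t * exp (- h t)"] by auto
  have Gh: "G t = G 0 * exp (h t)" if "t \<in> ?I" for t
  proof -
    have "c = G 0" using c[of 0] by (simp add: h_def)
    then have "G t * (exp (- h t) * exp (h t)) = G 0 * exp (h t)" using c[OF that] by (simp add: mult.assoc[symmetric])
    then show ?thesis by (simp add: exp_minus)
  qed
  define \<phi> where "\<phi> = (\<lambda>t. Arg (G 0) + Im (h t))"
  show thesis
  proof (rule that)
    fix t assume t: "t \<in> ?I"
    have "(\<phi> has_vector_derivative Im (G' t / G t)) (at t within ?I)"
      unfolding \<phi>_def using bounded_linear.has_vector_derivative[OF bounded_linear_Im h[OF t]]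
      by (auto intro!: derivative_eq_intros)
    moreover have "Im (G' t / G t) = curve_det \<gamma> (of_angle t) / (norm (circle_deriv \<gamma> (of_angle t)))\<^sup>2"
      unfolding Im_divide power2_norm_eq_inner
      by (simp add: G_def G'_def plane_to_complex_def curve_det_def inner_2 power2_eq_square) (simp add: perp_def algebra_simps)
    ultimately show "(\<phi> has_real_derivative
        curve_det \<gamma> (of_angle t) / (norm (circle_deriv \<gamma> (of_angle t)))\<^sup>2) (at t within ?I)"
      by (simp add: has_real_derivative_iff_has_vector_derivative)
    define \<rho> where "\<rho> = norm (G 0) * exp (Re (h t))"
    have "G t = of_real (norm (G 0)) * cis (Arg (G 0)) * (of_real (exp (Re (h t))) * cis (Im (h t)))"
      using Gh[OF t] rcis_cmod_Arg[of "G 0"] by (simp add: rcis_def exp_eq_polar)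
    also have "\<dots> = of_real \<rho> * cis (\<phi> t)"
      by (simp add: \<rho>_def \<phi>_def cis_mult[symmetric])
    finally have "Re (G t) = \<rho> * cos (\<phi> t)" "Im (G t) = \<rho> * sin (\<phi> t)" by simp_all
    then have "circle_deriv \<gamma> (of_angle t) = vector [\<rho> * cos (\<phi> t), \<rho> * sin (\<phi> t)]"
      by (simp add: vec_eq_iff forall_2 G_def plane_to_complex_def)
    moreover have "\<rho> > 0" using G0[of 0] by (simp add: \<rho>_def)
    ultimately show "\<exists>\<rho>>0. circle_deriv \<gamma> (of_angle t) = vector [\<rho> * cos (\<phi> t), \<rho> * sin (\<phi> t)]" by blast
  qed
qed

lemma circle_null_of_angle_image:
  assumes "negligible S"
  shows "circle_null (of_angle ` S)"
proof -
  have "of_angle -` of_angle ` S = \<Union> (range (\<lambda>k::int. (+) (2 * pi * of_int k) ` S))"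
    by (auto simp: of_angle_eq_iff image_iff) (metis add.commute of_angle_eq_iff)+
  moreover have "negligible \<dots>"
    by (rule negligible_countable_Union) (use assms negligible_translation in auto)
  ultimately show ?thesis by (simp add: circle_null_def)
qed

text \<open>A rotation by \<open>\<tau>\<close> is bad for \<open>m\<close> if \<open>\<phi> t + \<tau>\<close> equals the argument of \<open>m\<close> modulo \<open>\<pi>\<close> for some critical point \<open>t\<close> of
the tangent angle \<open>\<phi>\<close>. So the bad angles come from finitely many reflected translates of the compact null set
of critical values of \<open>\<phi>\<close>; modulo \<open>2 \<pi>\<close>, the offsets \<open>0\<close> and \<open>\<pi>\<close> suffice.\<close>

lemma degenerate_rotations_null:
  assumes \<gamma>: "C2_curve \<gamma>" and nz: "\<And>\<theta>. circle_deriv \<gamma> \<theta> \<noteq> 0" and "finite M" "0 \<notin> M"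
  obtains K where "compact K" "circle_null K"
    "\<And>\<theta> m. m \<in> M \<Longrightarrow> \<theta> \<notin> K \<Longrightarrow> curved_at_tangents_to (rotation \<theta> \<circ> \<gamma>) m"
proof -
  let ?I = "{0..2*pi}"
  obtain \<phi> where \<phi>: "\<And>t. t \<in> ?I \<Longrightarrow> (\<phi> has_real_derivative
        curve_det \<gamma> (of_angle t) / (norm (circle_deriv \<gamma> (of_angle t)))\<^sup>2) (at t within ?I)"
    and polar: "\<And>t. t \<in> ?I \<Longrightarrow> \<exists>\<rho>>0. circle_deriv \<gamma> (of_angle t) = vector [\<rho> * cos (\<phi> t), \<rho> * sin (\<phi> t)]"
    using tangent_angle_lift[OF \<gamma> nz] by metis
  define C where "C = {t \<in> ?I. curve_det \<gamma> (of_angle t) = 0}"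
  have "continuous_on UNIV (\<lambda>t. curve_det \<gamma> (of_angle t))"
    by (rule continuous_on_compose2[OF C2_curve_continuous(3)[OF \<gamma>] continuous_of_angle]) auto
  then have "closed {t. curve_det \<gamma> (of_angle t) = 0}" by (intro closed_Collect_eq) auto
  moreover have "C = ?I \<inter> {t. curve_det \<gamma> (of_angle t) = 0}" by (auto simp: C_def)
  ultimately have "compact C" by (simp add: compact_Int_closed)
  have "continuous_on ?I \<phi>"
    using \<phi> has_field_derivative_imp_has_derivative has_derivative_continuous
    by (fastforce simp: continuous_on_eq_continuous_within)
  then have cv: "compact (\<phi> ` C)"
    using \<open>compact C\<close> compact_continuous_image continuous_on_subset by (metis (no_types, lifting) C_def mem_Collect_eq subsetI)
  have "negligible (\<phi> ` C)"
  proof (rule negligible_critical_values)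
    fix t assume t: "t \<in> C"
    then have "(\<phi> has_real_derivative 0) (at t within ?I)" using \<phi>[of t] by (simp add: C_def)
    then show "(\<phi> has_real_derivative 0) (at t within C)" by (rule DERIV_subset) (auto simp: C_def)
  qed
  define S where "S = (\<Union>m\<in>M. \<Union>j\<in>{0, pi}. (\<lambda>s. (Arg (plane_to_complex m) + j) - s) ` \<phi> ` C)"
  have "compact S" unfolding S_def
    using \<open>finite M\<close> by (intro compact_UN compact_continuous_image cv) (auto intro!: continuous_intros)
  have "negligible ((\<lambda>s. c - s) ` \<phi> ` C)" for c
    by (rule negligible_differentiable_image_negligible[OF _ \<open>negligible (\<phi> ` C)\<close>])
       (auto intro!: derivative_intros)
  then have "negligible S" unfolding S_def
    using \<open>finite M\<close> by (intro negligible_Union finite_imageI) (auto intro!: negligible_Un)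
  show thesis
  proof (rule that)
    show "compact (of_angle ` S)"
      using \<open>compact S\<close> continuous_of_angle by (meson compact_continuous_image continuous_on_subset subset_UNIV)
    show "circle_null (of_angle ` S)" using \<open>negligible S\<close> by (rule circle_null_of_angle_image)
    fix \<theta> m assume m: "m \<in> M" and \<theta>: "\<theta> \<notin> of_angle ` S"
    show "curved_at_tangents_to (rotation \<theta> \<circ> \<gamma>) m"
      unfolding curved_at_tangents_to_def
    proof (intro allI impI notI)
      fix \<sigma>
      assume z: "perp (circle_deriv (rotation \<theta> \<circ> \<gamma>) \<sigma>) \<bullet> m = 0" "curve_det (rotation \<theta> \<circ> \<gamma>) \<sigma> = 0"
      have "\<sigma> \<in> (\<lambda>u. of_angle (2 * pi * u)) ` {0..1}"
        using range_of_angle_period[of id] by simp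
      then obtain u where u: "u \<in> {0..1}" "\<sigma> = of_angle (2 * pi * u)" by blast
      then have "2 * pi * u \<in> ?I" by (auto simp: mult_le_cancel_left)
      then obtain t where t: "t \<in> ?I" "\<sigma> = of_angle t" using u(2) by blast
      have tC: "t \<in> C" using z(2) t by (simp add: C_def rotated_C2_curve[OF \<gamma>])
      obtain \<rho> where \<rho>: "\<rho> > 0" "circle_deriv \<gamma> \<sigma> = vector [\<rho> * cos (\<phi> t), \<rho> * sin (\<phi> t)]"
        using polar t by blast
      define \<tau> where "\<tau> = rep_angle \<theta>"
      have th: "\<theta> = of_angle \<tau>" by (simp add: \<tau>_def)
      define \<alpha> where "\<alpha> = Arg (plane_to_complex m)"
      define R where "R = norm (plane_to_complex m)"
      have "m \<noteq> 0" using m \<open>0 \<notin> M\<close> by auto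
      then have R0: "R > 0"
        by (auto simp: R_def plane_to_complex_def complex_eq_iff vec_eq_iff forall_2)
      have "plane_to_complex m = of_real R * cis \<alpha>"
        using rcis_cmod_Arg[of "plane_to_complex m"] by (simp add: rcis_def R_def \<alpha>_def)
      then have mR: "m $ 1 = R * cos \<alpha>" "m $ 2 = R * sin \<alpha>"
        by (auto simp: plane_to_complex_def complex_eq_iff)
      have "perp (rotation \<theta> (circle_deriv \<gamma> \<sigma>)) \<bullet> m = \<rho> * R * sin (\<alpha> - (\<phi> t + \<tau>))"
        unfolding th \<rho>(2) inner_2 mR sin_diff sin_add cos_add
        by (simp add: rotation_of_angle perp_def algebra_simps)
      moreover have "\<alpha> - (\<phi> t + \<tau>) = \<alpha> - \<phi> t - \<tau>" by simp
      ultimately have "sin (\<alpha> - \<phi> t - \<tau>) = 0" using z(1) \<rho>(1) R0 by (simp add: rotated_C2_curve[OF \<gamma>])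
      then obtain i :: int where i: "\<alpha> - \<phi> t - \<tau> = of_int i * pi" using sin_zero_iff_int2 by blast
      have "\<exists>j\<in>{0, pi}. of_angle \<tau> = of_angle (\<alpha> + j - \<phi> t)"
      proof (cases "even i")
        case True
        then obtain k where k: "i = 2 * k" by blast
        have "\<alpha> - \<phi> t = \<tau> + 2 * pi * of_int k" using i by (simp add: k algebra_simps)
        then have "of_angle \<tau> = of_angle (\<alpha> - \<phi> t)" unfolding of_angle_eq_iff by blast
        then show ?thesis by simp
      next
        case False
        then obtain k where k: "i = 2 * k + 1" by (elim oddE)
        have "\<alpha> + pi - \<phi> t = \<tau> + 2 * pi * of_int (k + 1)" using i by (simp add: k algebra_simps)
        then have "of_angle \<tau> = of_angle (\<alpha> + pi - \<phi> t)" unfolding of_angle_eq_iff by blast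
        then show ?thesis by simp
      qed
      then obtain j where j: "j \<in> {0, pi}" "\<theta> = of_angle (\<alpha> + j - \<phi> t)" using th by blast
      have "\<alpha> + j - \<phi> t \<in> S" unfolding S_def \<alpha>_def using m j(1) tC by blast
      with \<theta> j(2) show False by blast
    qed
  qed
qed

lemma almost_every_rotation_nondegenerate:
  assumes \<gamma>: "\<gamma> \<in> regular_curves"
  obtains K where "compact K" "circle_null K"
    "\<And>\<theta>. \<theta> \<in> proper_angles (enclosed \<gamma>) \<Longrightarrow> \<theta> \<notin> K \<Longrightarrow> rotation \<theta> \<circ> \<gamma> \<in> nondegenerate_curves"
proof -
  note R = regular_curve_region[OF \<gamma>]
  obtain W where W: "0 < W" "width_ge \<gamma> W" using regular_curve_width[OF \<gamma>] .
  define M where "M = {m \<in> int_lattice. m \<noteq> 0 \<and> norm m * (W / 2) \<le> 1}"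
  have "M \<subseteq> int_lattice \<inter> cball 0 (2 / W)" using W by (auto simp: M_def field_simps)
  then have "finite M" using finite_bounded_int_lattice[OF bounded_cball] finite_subset by blast
  moreover have "0 \<notin> M" by (simp add: M_def)
  ultimately obtain K where K: "compact K" "circle_null K"
    "\<And>\<theta> m. m \<in> M \<Longrightarrow> \<theta> \<notin> K \<Longrightarrow> curved_at_tangents_to (rotation \<theta> \<circ> \<gamma>) m"
    using degenerate_rotations_null[OF R(1,10)] by metis
  show thesis
  proof (rule that[OF K(1,2)])
    fix \<theta> assume \<theta>: "\<theta> \<in> proper_angles (enclosed \<gamma>)" "\<theta> \<notin> K"
    have "curved_at_tangents_to (rotation \<theta> \<circ> \<gamma>) m" if "m \<in> int_lattice" "m \<noteq> 0" "norm m * (W / 2) \<le> 1" for m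
      using K(3)[OF _ \<theta>(2)] that by (auto simp: M_def)
    then show "rotation \<theta> \<circ> \<gamma> \<in> nondegenerate_curves"
      unfolding nondegenerate_curves_def
      using rotated_regular_curve[OF \<gamma> \<theta>(1)] width_ge_rotation[OF W(2)] W(1)
      by (intro CollectI conjI exI[of _ "W / 2"] exI[of _ W]) auto
  qed
qed

section \<open>Small rotations and density\<close>

lemma rotation_displacement: "norm (rotation (of_angle \<tau>) x - x) \<le> \<bar>\<tau>\<bar> * norm x"
proof (rule power2_le_imp_le)
  have cs: "cos \<tau> * cos \<tau> + sin \<tau> * sin \<tau> = 1" using sin_cos_squared_add3[of \<tau>] .
  have half: "cos \<tau> = 1 - 2 * (sin (\<tau> / 2))\<^sup>2" using cos_double_sin[of "\<tau> / 2"] by simp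
  have "(norm (rotation (of_angle \<tau>) x - x))\<^sup>2 = (2 - 2 * cos \<tau>) * (norm x)\<^sup>2"
    unfolding power2_norm_eq_inner inner_2 by (simp add: rotation_of_angle) (use cs in algebra)
  also have "2 - 2 * cos \<tau> = (2 * sin (\<tau> / 2))\<^sup>2" unfolding half by (simp add: power2_eq_square)
  also have "(2 * sin (\<tau> / 2))\<^sup>2 * (norm x)\<^sup>2 \<le> \<tau>\<^sup>2 * (norm x)\<^sup>2"
  proof (rule mult_right_mono)
    have "\<bar>2 * sin (\<tau> / 2)\<bar> \<le> \<bar>\<tau>\<bar>" using abs_sin_x_le_abs_x[of "\<tau> / 2"] by (simp add: abs_mult)
    then show "(2 * sin (\<tau> / 2))\<^sup>2 \<le> \<tau>\<^sup>2" by (simp only: abs_le_square_iff)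
  qed simp
  finally show "(norm (rotation (of_angle \<tau>) x - x))\<^sup>2 \<le> (\<bar>\<tau>\<bar> * norm x)\<^sup>2"
    by (simp add: power_mult_distrib)
qed simp

text \<open>The differences of points of the closure form a compact set that avoids the nonzero lattice points, hence stays at a
positive distance from them, and small rotations move this set only a little.\<close>

lemma small_angles_proper:
  assumes "properly_projected E"
  obtains \<eta> where "0 < \<eta>" "\<And>\<tau>. \<bar>\<tau>\<bar> < \<eta> \<Longrightarrow> of_angle \<tau> \<in> proper_angles E"
proof -
  have E: "bounded E" "open E" "inj_on torus_proj (closure E)"
    using assms by (auto simp: properly_projected_def)
  define D where "D = {x - y | x y. x \<in> closure E \<and> y \<in> closure E}"
  have cD: "compact D" unfolding D_def using E(1) by (intro compact_differences) (auto simp: compact_closure)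
  have cL: "closed (int_lattice - {0})" by (rule closed_int_lattice) auto
  have disj: "D \<inter> (int_lattice - {0}) = {}"
  proof (rule equals0I)
    fix k assume "k \<in> D \<inter> (int_lattice - {0})"
    then obtain x y where k: "x \<in> closure E" "y \<in> closure E" "k = x - y" "k \<in> int_lattice" "k \<noteq> 0"
      by (auto simp: D_def)
    then have "torus_proj y = torus_proj x" by (simp add: torus_proj_eq_iff)
    then have "y = x" using E(3) k(1,2) by (auto dest: inj_onD)
    then show False using k(3,5) by simp
  qed
  obtain d where d0: "0 < d" "\<forall>z\<in>D. \<forall>k\<in>int_lattice - {0}. d \<le> dist z k"
    using separate_compact_closed[OF cD cL disj] by (elim exE conjE)
  then have d: "0 < d" "\<And>z k. z \<in> D \<Longrightarrow> k \<in> int_lattice - {0} \<Longrightarrow> d \<le> dist z k" by simp_all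
  obtain B where B: "0 < B" "\<And>z. z \<in> D \<Longrightarrow> norm z \<le> B"
    using compact_imp_bounded[OF cD] bounded_pos by blast
  show thesis
  proof (rule that[of "d / B"])
    show "0 < d / B" using d B by simp
    fix \<tau> assume \<tau>: "\<bar>\<tau>\<bar> < d / B"
    let ?R = "rotation (of_angle \<tau>)"
    have "inj_on torus_proj (?R ` closure E)"
    proof (rule inj_onI, clarify)
      fix x y assume xy: "x \<in> closure E" "y \<in> closure E" "torus_proj (?R x) = torus_proj (?R y)"
      have z: "y - x \<in> D" using xy by (auto simp: D_def)
      have k: "?R (y - x) \<in> int_lattice"
        using xy(3) by (simp add: torus_proj_eq_iff linear_diff[OF linear_rotation])
      have "dist (y - x) (?R (y - x)) \<le> \<bar>\<tau>\<bar> * norm (y - x)"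
        using rotation_displacement[of \<tau> "y - x"] by (simp add: dist_norm norm_minus_commute)
      also have "\<dots> \<le> \<bar>\<tau>\<bar> * B" using B(2)[OF z] by (intro mult_left_mono) auto
      also have "\<dots> < d" using \<tau> B(1) by (simp add: pos_less_divide_eq)
      finally have "?R (y - x) = 0" using d(2)[OF z] k by force
      then have "norm (y - x) = 0" by (metis norm_rotation norm_zero)
      then show "?R x = ?R y" by simp
    qed
    moreover have "closure (?R ` E) = ?R ` closure E"
      by (rule closure_injective_linear_image[symmetric, OF linear_rotation bij_is_inj[OF bij_rotation]])
    moreover have "bounded (?R ` E)" using E(1) bounded_linear_rotation by (rule bounded_linear_image)
    moreover have "open (?R ` E)"
      using E(2) open_bijective_linear_image_eq[OF linear_rotation bij_rotation] by blast
    ultimately show "of_angle \<tau> \<in> proper_angles E"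
      by (simp add: proper_angles_def properly_projected_def)
  qed
qed

lemma C2_dist_rotation:
  assumes \<gamma>: "C2_curve \<gamma>"
  obtains B where "0 < B" "\<And>\<tau>. C2_dist \<gamma> (rotation (of_angle \<tau>) \<circ> \<gamma>) \<le> \<bar>\<tau>\<bar> * B"
proof -
  note C = C2_curve_bounded[OF \<gamma>]
  obtain b0 b1 b2 where b: "0 < b0" "0 < b1" "0 < b2"
      "\<And>\<theta>. norm (\<gamma> \<theta>) \<le> b0" "\<And>\<theta>. norm (circle_deriv \<gamma> \<theta>) \<le> b1"
      "\<And>\<theta>. norm (circle_deriv (circle_deriv \<gamma>) \<theta>) \<le> b2"
    using C unfolding bounded_pos by blast
  have sup: "(SUP \<theta>. dist (f \<theta>) ((rotation (of_angle \<tau>) \<circ> f) \<theta>)) \<le> \<bar>\<tau>\<bar> * b"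
    if "\<And>\<theta>. norm (f \<theta>) \<le> b" for f :: "circle \<Rightarrow> real^2" and b \<tau>
  proof (rule cSUP_least)
    fix \<theta> :: circle
    have "dist (f \<theta>) ((rotation (of_angle \<tau>) \<circ> f) \<theta>) \<le> \<bar>\<tau>\<bar> * norm (f \<theta>)"
      using rotation_displacement[of \<tau> "f \<theta>"] by (simp add: dist_norm norm_minus_commute)
    also have "\<dots> \<le> \<bar>\<tau>\<bar> * b" using that by (intro mult_left_mono) auto
    finally show "dist (f \<theta>) ((rotation (of_angle \<tau>) \<circ> f) \<theta>) \<le> \<bar>\<tau>\<bar> * b" .
  qed simp
  show thesis
  proof (rule that[of "b0 + b1 + b2"])
    fix \<tau>
    have "C2_dist \<gamma> (rotation (of_angle \<tau>) \<circ> \<gamma>) \<le> \<bar>\<tau>\<bar> * b0 + \<bar>\<tau>\<bar> * b1 + \<bar>\<tau>\<bar> * b2"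
      unfolding C2_dist_def rotated_C2_curve(3)[OF \<gamma>] unfolding rotated_C2_curve(2)[OF \<gamma>]
      using \<gamma> rotated_C2_curve(1)[OF \<gamma>] sup[of \<gamma> b0 \<tau>, OF b(4)] sup[of "circle_deriv \<gamma>" b1 \<tau>, OF b(5)] sup[of "circle_deriv (circle_deriv \<gamma>)" b2 \<tau>, OF b(6)] by simp
    then show "C2_dist \<gamma> (rotation (of_angle \<tau>) \<circ> \<gamma>) \<le> \<bar>\<tau>\<bar> * (b0 + b1 + b2)"
      by (simp add: algebra_simps)
  qed (use b in simp)
qed

lemma nondegenerate_curves_dense:
  "(subtopology C2_topology regular_curves) closure_of nondegenerate_curves = regular_curves"
proof
  interpret C2: Metric_space "Collect C2_curve" C2_dist by (rule Metric_space_C2)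
  have sub: "regular_curves \<subseteq> Collect C2_curve" by (auto simp: regular_curves_def)
  have top: "topspace (subtopology C2_topology regular_curves) = regular_curves"
    using sub by (auto simp: C2_topology_def)
  show "(subtopology C2_topology regular_curves) closure_of nondegenerate_curves \<subseteq> regular_curves"
    using closure_of_subset_topspace[of "subtopology C2_topology regular_curves"] top by simp
  show "regular_curves \<subseteq> (subtopology C2_topology regular_curves) closure_of nondegenerate_curves"
  proof
    fix \<gamma> assume \<gamma>: "\<gamma> \<in> regular_curves"
    then have C: "C2_curve \<gamma>" and P: "properly_projected (enclosed \<gamma>)" by (auto simp: regular_curves_def)
    obtain K where K: "circle_null K"
      "\<And>\<theta>. \<theta> \<in> proper_angles (enclosed \<gamma>) \<Longrightarrow> \<theta> \<notin> K \<Longrightarrow> rotation \<theta> \<circ> \<gamma> \<in> nondegenerate_curves"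
      using almost_every_rotation_nondegenerate[OF \<gamma>] by blast
    obtain \<eta> where \<eta>: "0 < \<eta>" "\<And>\<tau>. \<bar>\<tau>\<bar> < \<eta> \<Longrightarrow> of_angle \<tau> \<in> proper_angles (enclosed \<gamma>)"
      using small_angles_proper[OF P] by blast
    obtain B where B: "0 < B" "\<And>\<tau>. C2_dist \<gamma> (rotation (of_angle \<tau>) \<circ> \<gamma>) \<le> \<bar>\<tau>\<bar> * B"
      using C2_dist_rotation[OF C] by blast
    show "\<gamma> \<in> (subtopology C2_topology regular_curves) closure_of nondegenerate_curves"
      unfolding in_closure_of top
    proof (intro conjI \<gamma> allI impI, elim conjE)
      fix T assume T: "\<gamma> \<in> T" "openin (subtopology C2_topology regular_curves) T"
      then obtain S where S: "openin C2.mtopology S" "T = S \<inter> regular_curves"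
        by (auto simp: openin_subtopology C2_topology_def)
      then obtain r where r: "0 < r" "C2.mball \<gamma> r \<subseteq> S"
        using T(1) C2.openin_mtopology by blast
      define e where "e = min \<eta> (r / B)"
      have "0 < e" using \<eta> r B by (simp add: e_def)
      have "\<not> negligible {0<..<e}"
        using \<open>0 < e\<close> by (simp add: negligible_convex_interior)
      then have "\<not> {0<..<e} \<subseteq> of_angle -` K"
        using K(1) negligible_subset unfolding circle_null_def by blast
      then obtain \<tau> where \<tau>: "\<tau> \<in> {0<..<e}" "of_angle \<tau> \<notin> K" by blast
      let ?\<delta> = "rotation (of_angle \<tau>) \<circ> \<gamma>"
      have \<delta>: "?\<delta> \<in> nondegenerate_curves" using K(2) \<eta>(2) \<tau> by (auto simp: e_def)
      then have reg: "?\<delta> \<in> regular_curves" by (simp add: nondegenerate_curves_def)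
      have "\<tau> * B < r" using \<tau>(1) B(1) by (simp add: e_def pos_less_divide_eq)
      then have "C2_dist \<gamma> ?\<delta> < r" using B(2)[of \<tau>] \<tau>(1) by simp
      then have "?\<delta> \<in> C2.mball \<gamma> r" using reg sub C by auto
      then show "\<exists>\<delta>. \<delta> \<in> nondegenerate_curves \<and> \<delta> \<in> T" using \<delta> reg r(2) S(2) by blast
    qed
  qed
qed

theorem proposition1p20:
  shows "\<exists>Y. Y \<subseteq> regular_curves \<and>
     openin (subtopology C2_topology regular_curves) Y \<and>
     (subtopology C2_topology regular_curves) closure_of Y = regular_curves \<and>
     (\<forall>\<gamma>\<in>Y.
        glancing_set (torus_proj ` enclosed \<gamma>) \<subseteq> torus_proj ` \<gamma> ` {\<theta>. curvature \<gamma> \<theta> > 0} \<and>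
        (\<forall>z \<in> glancing_set (torus_proj ` enclosed \<gamma>). \<forall>L.
           glancing_line (torus_proj ` enclosed \<gamma>) L \<and> z \<in> L \<longrightarrow>
           has_order (torus_proj ` enclosed \<gamma>) L z 2)) \<and>
     (\<forall>\<gamma>\<in>regular_curves. \<exists>K :: circle set. compact K \<and> circle_null K \<and>
        (\<forall>\<theta> \<in> proper_angles (enclosed \<gamma>) - K. rotation \<theta> \<circ> \<gamma> \<in> Y))"
proof (rule exI[of _ nondegenerate_curves], intro conjI openin_nondegenerate_curves nondegenerate_curves_dense ballI)
  show "nondegenerate_curves \<subseteq> regular_curves" by (auto simp: nondegenerate_curves_def)
next
  fix \<gamma> assume \<gamma>: "\<gamma> \<in> nondegenerate_curves"
  then have reg: "\<gamma> \<in> regular_curves" by (simp add: nondegenerate_curves_def)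
  show "glancing_set (torus_proj ` enclosed \<gamma>) \<subseteq> torus_proj ` \<gamma> ` {\<theta>. curvature \<gamma> \<theta> > 0}"
  proof
    fix z assume "z \<in> glancing_set (torus_proj ` enclosed \<gamma>)"
    then obtain L where z: "z \<in> frontier (torus_proj ` enclosed \<gamma>)"
      and L: "glancing_line (torus_proj ` enclosed \<gamma>) L" "z \<in> L"
      unfolding glancing_set_def by blast
    obtain \<sigma> where \<sigma>: "z = torus_proj (\<gamma> \<sigma>)" using glancing_point_on_curve[OF reg z] .
    have "curve_det \<gamma> \<sigma> \<noteq> 0" using nondegenerate_glancing_point_curved[OF \<gamma> L(1)] L(2) \<sigma> by blast
    then have "curvature \<gamma> \<sigma> > 0" using curvature_pos regular_curve_region(10)[OF reg] by blast
    then show "z \<in> torus_proj ` \<gamma> ` {\<theta>. curvature \<gamma> \<theta> > 0}" unfolding \<sigma> by blast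
  qed
next
  fix \<gamma> z assume \<gamma>: "\<gamma> \<in> nondegenerate_curves" and z: "z \<in> glancing_set (torus_proj ` enclosed \<gamma>)"
  then have reg: "\<gamma> \<in> regular_curves" by (simp add: nondegenerate_curves_def)
  obtain \<sigma> where \<sigma>: "z = torus_proj (\<gamma> \<sigma>)"
    using glancing_point_on_curve[OF reg] z unfolding glancing_set_def by blast
  show "\<forall>L. glancing_line (torus_proj ` enclosed \<gamma>) L \<and> z \<in> L \<longrightarrow> has_order (torus_proj ` enclosed \<gamma>) L z 2"
    unfolding \<sigma> using curved_glancing_point_has_order_2[OF reg] nondegenerate_glancing_point_curved[OF \<gamma>] by blast
next
  fix \<gamma> assume "\<gamma> \<in> regular_curves"
  then show "\<exists>K :: circle set. compact K \<and> circle_null K \<and>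
        (\<forall>\<theta> \<in> proper_angles (enclosed \<gamma>) - K. rotation \<theta> \<circ> \<gamma> \<in> nondegenerate_curves)"
    using almost_every_rotation_nondegenerate by (metis DiffD1 DiffD2)
qed

end
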